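(* Let $n\in\mathbb{N}$, let $\mathrm{tr}=\frac1n\mathrm{Tr}$ be the normalized trace on $M_n=M_n(\mathbb{C})$, let $D$ be the dephasing graph on $(M_n,\mathrm{tr})$, and let $s:M_n\to L\mathcal{O}(M_n,\mathrm{tr},D)$ be the universal local quantum Cuntz--Krieger $(M_n,\mathrm{tr},D)$-family. For $1\le i,j\le n$ set $$t_{ij}:=\sqrt n\; s(f_{ij}),\qquad V_i:=\sum_{j=1}^n t_{ij}.$$ Then $\{V_i:1\le i\le n\}$ consists of Cuntz isometries, i.e. $V_i^*V_i=1$ for each $i$ and $\sum_{i=1}^nV_iV_i^*=1$, and they generate all of $L\mathcal{O}(M_n,\mathrm{tr},D)$ as a $C^*$-algebra. Consequently $L\mathcal{O}(M_n,\mathrm{tr},D)$ is isomorphic to the Cuntz algebra $\mathcal{O}_n$.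
   Context: Let $B=M_n(\mathbb{C})$ with state $\psi=\mathrm{tr}=\frac1n\mathrm{Tr}$, and put $\delta=n$ (so $\psi$ is a $\delta$-form: its density matrix $\rho=\frac1n 1$ satisfies $\mathrm{Tr}(\rho^{-1})=\delta^2=n^2$). Let $e_{ij}$ be the standard matrix units; the adapted matrix units are $f_{ij}:=\psi(e_{ii})^{-1/2}\psi(e_{jj})^{-1/2}e_{ij}=n\,e_{ij}$. Let $m:B\otimes B\to B$, $m(x\otimes y)=xy$, and let $m^*:B\to B\otimes B$ be its Hilbert space adjoint with respect to the inner products $\langle x,y\rangle=\psi(x^*y)$ on $B$ and the one induced by $\psi\otimes\psi$ on $B\otimes B$. (Then $m^*(f_{ij})=\sum_k f_{ik}\otimes f_{kj}$.) The dephasing graph is the linear map $D:M_n\to M_n$ determined by $D(f_{ij})=\delta_{i=j}\,\psi(e_{ii})\,\delta^2 f_{ii}=\delta_{i=j}\,n f_{ii}$, where $\delta_{i=j}$ is the Kronecker delta; it is completely positive and satisfies $m(D\otimes D)m^*=\delta^2D$. For a unital $C^*$-algebra $\mathcal{C}$ let $\mu:\mathcal{C}\odot\mathcal{C}\to\mathcal{C}$, $\mu(x\otimes y)=xy$. For a linear map $S:B\to\mathcal{C}$, let $S^*:B\to\mathcal{C}$ be the linear map $S^*(x):=S(x^* )^*$. For a linear map $A:B\to B$, $S$ is a local quantum Cuntz--Krieger $(B,\psi,A)$-family if (LQCK1) $\mu(\mu\otimes\mathrm{id})(S\otimes S^*\otimes S)(m^*\otimes\mathrm{id})=\delta^{-2}S\,m$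 as maps $B\otimes B\to\mathcal{C}$; (LQCK2) $\mu(S^*\otimes S)=\delta^{-2}\mu(S\otimes S^* )m^*A\,m$ as maps $B\otimes B\to\mathcal{C}$; (LQCK3) $\mu(S\otimes S^* )m^*(1_B)=\delta^{-2}1_{\mathcal{C}}$. Such a family $s$ is universal if for every local quantum Cuntz--Krieger $(B,\psi,A)$-family $S$ (into any unital $C^*$-algebra) there is a surjective $*$-homomorphism $\rho:C^*(s(B))\to C^*(S(B))$ with $\rho\circ s=S$. The local quantum Cuntz--Krieger algebra $L\mathcal{O}(B,\psi,A)$ is the $C^*$-algebra generated by the range of the universal family. $\mathcal{O}_n$ is the universal unital $C^*$-algebra generated by isometries $v_1,\dots,v_n$ with $\sum_i v_iv_i^*=1$. *)

theory Defs
  imports "HOL-Analysis.Analysis" "HOL-Algebra.Module"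
begin

section \<open>Unital C*-algebras\<close>

text \<open>
  The universal properties below quantify over all unital C*-algebras, so C*-algebras are
  records with an explicit carrier rather than types. The carriers are subsets of a type
  \<open>'u\<close>, which is left arbitrary and plays the role of a universe.
\<close>

definition complex_ring :: "complex ring" where
  "complex_ring = \<lparr>carrier = UNIV, mult = (*), one = 1, zero = 0, add = (+)\<rparr>"

record 'u cstar = "(complex, 'u) module" +
  star :: "'u \<Rightarrow> 'u"
  cnorm :: "'u \<Rightarrow> real"

text \<open>
  The locale \<open>Metric_space\<close> requires symmetry and non-negativity also outside of the carrier,
  whence the case distinction.
\<close>

definition cdist :: "'u cstar \<Rightarrow> 'u \<Rightarrow> 'u \<Rightarrow> real" where
  "cdist A x y =
     (if x \<in> carrier A \<and> y \<in> carrier A then cnorm A (x \<ominus>\<^bsub>A\<^esub> y) else 0)"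

text \<open>The zero algebra, in which \<open>\<one> = \<zero>\<close>, is admitted.\<close>

locale pre_cstar_algebra = Ring.ring A + scalar: Module.module complex_ring A
  for A :: "'u cstar" (structure) +
  assumes smult_mult_left: "\<And>c x y. \<lbrakk>x \<in> carrier A; y \<in> carrier A\<rbrakk>
            \<Longrightarrow> (c \<odot> x) \<otimes> y = c \<odot> (x \<otimes> y)"
    and smult_mult_right: "\<And>c x y. \<lbrakk>x \<in> carrier A; y \<in> carrier A\<rbrakk>
            \<Longrightarrow> x \<otimes> (c \<odot> y) = c \<odot> (x \<otimes> y)"
    and star_closed: "\<And>x. x \<in> carrier A \<Longrightarrow> star A x \<in> carrier A"
    and star_star: "\<And>x. x \<in> carrier A \<Longrightarrow> star A (star A x) = x"
    and star_add: "\<And>x y. \<lbrakk>x \<in> carrier A; y \<in> carrier A\<rbrakk>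
            \<Longrightarrow> star A (x \<oplus> y) = star A x \<oplus> star A y"
    and star_smult: "\<And>c x. x \<in> carrier A \<Longrightarrow> star A (c \<odot> x) = cnj c \<odot> star A x"
    and star_mult: "\<And>x y. \<lbrakk>x \<in> carrier A; y \<in> carrier A\<rbrakk>
            \<Longrightarrow> star A (x \<otimes> y) = star A y \<otimes> star A x"
    and cnorm_nonneg: "\<And>x. x \<in> carrier A \<Longrightarrow> 0 \<le> cnorm A x"
    and cnorm_eq_0: "\<And>x. x \<in> carrier A \<Longrightarrow> cnorm A x = 0 \<longleftrightarrow> x = \<zero>"
    and cnorm_triangle: "\<And>x y. \<lbrakk>x \<in> carrier A; y \<in> carrier A\<rbrakk>
            \<Longrightarrow> cnorm A (x \<oplus> y) \<le> cnorm A x + cnorm A y"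
    and cnorm_smult: "\<And>c x. x \<in> carrier A \<Longrightarrow> cnorm A (c \<odot> x) = cmod c * cnorm A x"
    and cnorm_mult: "\<And>x y. \<lbrakk>x \<in> carrier A; y \<in> carrier A\<rbrakk>
            \<Longrightarrow> cnorm A (x \<otimes> y) \<le> cnorm A x * cnorm A y"
    and cstar_identity: "\<And>x. x \<in> carrier A \<Longrightarrow> cnorm A (star A x \<otimes> x) = (cnorm A x)\<^sup>2"

lemma (in pre_cstar_algebra) Metric_space_cdist: "Metric_space (carrier A) (cdist A)"
proof
  have uminus: "\<ominus> x = (-1) \<odot> x" if "x \<in> carrier A" for x
  proof -
    have c: "a \<in> carrier complex_ring" for a :: complex
      by (simp add: complex_ring_def)
    have "\<ominus>\<^bsub>complex_ring\<^esub> \<one>\<^bsub>complex_ring\<^esub> = -1"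
      by (rule scalar.R.minus_equality) (auto simp: complex_ring_def)
    with scalar.smult_l_minus[OF scalar.R.one_closed that] c scalar.smult_one[OF that] show ?thesis by simp
  qed
  have flip: "cnorm A (x \<ominus> y) = cnorm A (y \<ominus> x)"
    if "x \<in> carrier A" "y \<in> carrier A" for x y
  proof -
    have "x \<ominus> y = \<ominus> (y \<ominus> x)"
      using that by (simp add: a_minus_def minus_add minus_minus a_comm)
    also have "cnorm A \<dots> = cnorm A (y \<ominus> x)"
      using that by (simp add: uminus cnorm_smult minus_closed)
    finally show ?thesis .
  qed
  show "0 \<le> cdist A x y" for x y
    by (simp add: cdist_def cnorm_nonneg minus_closed)
  show "cdist A x y = cdist A y x" for x y
    by (auto simp: cdist_def intro: flip)
  show "cdist A x y = 0 \<longleftrightarrow> x = y" if "x \<in> carrier A" "y \<in> carrier A" for x y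
  proof -
    have "x = (x \<ominus> y) \<oplus> y" "x \<ominus> x = \<zero>"
      using that by algebra+
    with that have "x \<ominus> y = \<zero> \<longleftrightarrow> x = y" by (metis l_zero)
    with that show ?thesis by (simp add: cdist_def cnorm_eq_0 minus_closed)
  qed
  show "cdist A x z \<le> cdist A x y + cdist A y z"
    if "x \<in> carrier A" "y \<in> carrier A" "z \<in> carrier A" for x y z
  proof -
    have "x \<ominus> z = (x \<ominus> y) \<oplus> (y \<ominus> z)"
      using that by algebra
    with that show ?thesis
      by (simp add: cdist_def cnorm_triangle minus_closed)
  qed
qed

locale cstar_algebra = pre_cstar_algebra +
  assumes complete: "Metric_space.mcomplete (carrier A) (cdist A)"

definition star_hom :: "'u cstar \<Rightarrow> 'v cstar \<Rightarrow> ('u \<Rightarrow> 'v) \<Rightarrow> bool" where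
  "star_hom A B \<phi> \<longleftrightarrow> \<phi> \<in> carrier A \<rightarrow> carrier B \<and>
     (\<forall>x\<in>carrier A. \<forall>y\<in>carrier A. \<phi> (x \<oplus>\<^bsub>A\<^esub> y) = \<phi> x \<oplus>\<^bsub>B\<^esub> \<phi> y) \<and>
     (\<forall>c. \<forall>x\<in>carrier A. \<phi> (c \<odot>\<^bsub>A\<^esub> x) = c \<odot>\<^bsub>B\<^esub> \<phi> x) \<and>
     (\<forall>x\<in>carrier A. \<forall>y\<in>carrier A. \<phi> (x \<otimes>\<^bsub>A\<^esub> y) = \<phi> x \<otimes>\<^bsub>B\<^esub> \<phi> y) \<and>
     (\<forall>x\<in>carrier A. \<phi> (star A x) = star B (\<phi> x))"

definition cstar_isomorphic :: "'u cstar \<Rightarrow> 'v cstar \<Rightarrow> bool" where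
  "cstar_isomorphic A B \<longleftrightarrow> (\<exists>\<phi>. star_hom A B \<phi> \<and> bij_betw \<phi> (carrier A) (carrier B))"

definition cstar_subalgebra :: "'u cstar \<Rightarrow> 'u set \<Rightarrow> bool" where
  "cstar_subalgebra A X \<longleftrightarrow> submodule X complex_ring A \<and>
     (\<forall>x\<in>X. \<forall>y\<in>X. x \<otimes>\<^bsub>A\<^esub> y \<in> X) \<and>
     (\<forall>x\<in>X. star A x \<in> X) \<and>
     closedin (Metric_space.mtopology (carrier A) (cdist A)) X"

definition cstar_generated :: "'u cstar \<Rightarrow> 'u set \<Rightarrow> 'u cstar" where
  "cstar_generated A X = A\<lparr>carrier := cstar_subalgebra A hull X\<rparr>"

section \<open>The Cuntz algebra\<close>

definition cuntz_isometries :: "'u cstar \<Rightarrow> ('n::finite \<Rightarrow> 'u) \<Rightarrow> bool" where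
  "cuntz_isometries A v \<longleftrightarrow> (\<forall>i. v i \<in> carrier A) \<and>
     (\<forall>i. star A (v i) \<otimes>\<^bsub>A\<^esub> v i = \<one>\<^bsub>A\<^esub>) \<and>
     (\<Oplus>\<^bsub>A\<^esub>i\<in>UNIV. v i \<otimes>\<^bsub>A\<^esub> star A (v i)) = \<one>\<^bsub>A\<^esub>"

text \<open>
  The index type \<open>'n\<close> of the generating isometries has \<open>n\<close> elements; the predicate says that
  \<open>Q\<close> with the generators \<open>v\<close> is the Cuntz algebra \<open>O\<^sub>n\<close>.
\<close>

definition is_cuntz_algebra :: "'u cstar \<Rightarrow> ('n::finite \<Rightarrow> 'u) \<Rightarrow> bool" where
  "is_cuntz_algebra Q v \<longleftrightarrow> cstar_algebra Q \<and> cuntz_isometries Q v \<and>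
     carrier (cstar_generated Q (range v)) = carrier Q \<and>
     (\<forall>(A :: 'u cstar) w. cstar_algebra A \<and> cuntz_isometries A w \<longrightarrow>
        (\<exists>\<phi>. star_hom Q A \<phi> \<and> \<phi> \<one>\<^bsub>Q\<^esub> = \<one>\<^bsub>A\<^esub> \<and> (\<forall>i. \<phi> (v i) = w i)))"

section \<open>Matrix algebras and their tensor products\<close>

text \<open>
  The algebra \<open>M\<^sub>n\<close> is \<open>complex^'n^'n\<close> with \<open>n = CARD('n)\<close>. The tensor product of the matrix
  algebras over \<open>'a\<close> and \<open>'b\<close> is the matrix algebra over \<open>'a \<times> 'b\<close>, the elementary tensors
  being the Kronecker products.
\<close>

type_synonym 'n cmat = "complex^'n^'n"

abbreviation cscale :: "complex \<Rightarrow> 'n::finite cmat \<Rightarrow> 'n cmat" where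
  "cscale c \<equiv> map_matrix ((*) c)"

definition cadj :: "'n::finite cmat \<Rightarrow> 'n cmat" where
  "cadj X = map_matrix cnj (transpose X)"

definition munit :: "'n \<Rightarrow> 'n \<Rightarrow> 'n::finite cmat" where
  "munit i j = axis i (axis j 1)"

definition ntr :: "'n::finite cmat \<Rightarrow> complex" where
  "ntr X = trace X / of_nat CARD('n)"

definition tr_inner :: "'n::finite cmat \<Rightarrow> 'n cmat \<Rightarrow> complex" where
  "tr_inner X Y = ntr (cadj X ** Y)"

definition tr_adjoint :: "('a::finite cmat \<Rightarrow> 'b::finite cmat) \<Rightarrow> 'b cmat \<Rightarrow> 'a cmat" where
  "tr_adjoint F = (THE G. \<forall>X Y. tr_inner (F X) Y = tr_inner X (G Y))"

definition adapted_unit :: "'n \<Rightarrow> 'n \<Rightarrow> 'n::finite cmat" where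
  "adapted_unit i j =
     cscale (inverse (csqrt (ntr (munit i i))) * inverse (csqrt (ntr (munit j j)))) (munit i j)"

definition tensor :: "'a::finite cmat \<Rightarrow> 'b::finite cmat \<Rightarrow> ('a \<times> 'b) cmat" where
  "tensor X Y = (\<chi> p q. X $ fst p $ fst q * Y $ snd p $ snd q)"

text \<open>
  The entry of \<open>T\<close> at row \<open>p\<close> and column \<open>q\<close> is its coefficient at the elementary tensor of
  \<open>munit (fst p) (fst q)\<close> and \<open>munit (snd p) (snd q)\<close>. The next three operations on tensors
  are the linear extensions of \<open>F X \<otimes> G Y\<close>, of \<open>X ** Y\<close> and of the product of \<open>F X\<close> and
  \<open>G Y\<close> in a C*-algebra, that is, \<open>F \<otimes> G\<close>, \<open>m\<close> and \<open>\<mu> (F \<otimes> G)\<close>, for linear \<open>F\<close> and \<open>G\<close>.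
\<close>

definition tensor_map ::
  "('a::finite cmat \<Rightarrow> 'c::finite cmat) \<Rightarrow> ('b::finite cmat \<Rightarrow> 'd::finite cmat) \<Rightarrow>
     ('a \<times> 'b) cmat \<Rightarrow> ('c \<times> 'd) cmat" where
  "tensor_map F G T = (\<Sum>p\<in>UNIV. \<Sum>q\<in>UNIV.
     cscale (T $ p $ q) (tensor (F (munit (fst p) (fst q))) (G (munit (snd p) (snd q)))))"

definition mat_mult :: "('n::finite \<times> 'n) cmat \<Rightarrow> 'n cmat" where
  "mat_mult T = (\<Sum>p\<in>UNIV. \<Sum>q\<in>UNIV.
     cscale (T $ p $ q) (munit (fst p) (fst q) ** munit (snd p) (snd q)))"

definition mult_tensor_map ::
  "'u cstar \<Rightarrow> ('a::finite cmat \<Rightarrow> 'u) \<Rightarrow> ('b::finite cmat \<Rightarrow> 'u) \<Rightarrow> ('a \<times> 'b) cmat \<Rightarrow> 'u"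
  where
  "mult_tensor_map C F G T = (\<Oplus>\<^bsub>C\<^esub>p\<in>UNIV. \<Oplus>\<^bsub>C\<^esub>q\<in>UNIV.
     (T $ p $ q) \<odot>\<^bsub>C\<^esub>
       (F (munit (fst p) (fst q)) \<otimes>\<^bsub>C\<^esub> G (munit (snd p) (snd q))))"

definition mat_comult :: "'n::finite cmat \<Rightarrow> ('n \<times> 'n) cmat" where
  "mat_comult = tr_adjoint mat_mult"

definition dephasing :: "'n::finite cmat \<Rightarrow> 'n cmat" where
  "dephasing X = (\<chi> i j. if i = j then of_nat CARD('n) * X $ i $ i else 0)"

lemma ntr_munit: "ntr (munit i j :: 'n::finite cmat) = (if i = j then 1 / of_nat CARD('n) else 0)"
  by (simp add: ntr_def trace_def munit_def axis_def if_distrib[of "\<lambda>x. x $ _"] cong: if_cong)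

lemma adapted_unit_eq: "adapted_unit i j = cscale (of_nat CARD('n)) (munit i j :: 'n::finite cmat)"
proof -
  have "csqrt (1 / of_nat CARD('n)) * csqrt (1 / of_nat CARD('n)) = 1 / complex_of_nat CARD('n)"
    by (metis power2_csqrt power2_eq_square)
  then have "inverse (csqrt (1 / of_nat CARD('n))) * inverse (csqrt (1 / of_nat CARD('n))) =
      complex_of_nat CARD('n)"
    by (metis inverse_mult_distrib inverse_divide div_by_1)
  then show ?thesis by (simp add: adapted_unit_def ntr_munit)
qed

lemma ntr_tensor: "ntr (tensor X Y) = ntr X * ntr Y"
  by (simp add: ntr_def trace_def tensor_def sum_product UNIV_Times_UNIV[symmetric]
      sum.cartesian_product case_prod_beta del: UNIV_Times_UNIV)

lemma munit_nth: "munit a b $ i $ j = (if a = i \<and> b = j then 1 else 0)"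
  by (simp add: munit_def axis_def)

lemma munit_mult: "munit a b ** munit c d = (if b = c then munit a d else 0)"
proof -
  have "(munit a b ** munit c d) $ i $ j = (if b = c then munit a d else 0) $ i $ j" for i j
  proof -
    have "(munit a b ** munit c d) $ i $ j =
        (\<Sum>k\<in>UNIV. if k = b then (if a = i \<and> b = c \<and> d = j then 1 else 0) else 0)"
      unfolding matrix_matrix_mult_def vec_lambda_beta munit_nth
      by (rule sum.cong) auto
    then show ?thesis by (simp add: munit_nth)
  qed
  then show ?thesis by (simp add: vec_eq_iff)
qed

lemma mat_mult_nth: "mat_mult T $ i $ j = (\<Sum>k\<in>UNIV. T $ (i, k) $ (k, j))"
proof -
  have "mat_mult T $ i $ j = (\<Sum>(a, k)\<in>UNIV. \<Sum>(l, b)\<in>UNIV.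
      if b = j then if l = k then if a = i then T $ (a, k) $ (l, b) else 0 else 0 else 0)"
    unfolding mat_mult_def sum_component nth_map_matrix munit_mult
    by (auto simp: munit_nth case_prod_beta intro!: sum.cong)
  also have "\<dots> = (\<Sum>a\<in>UNIV. \<Sum>k\<in>UNIV. if a = i then T $ (a, k) $ (k, j) else 0)"
    by (simp add: UNIV_Times_UNIV[symmetric] sum.cartesian_product[symmetric]
        del: UNIV_Times_UNIV)
  also have "\<dots> = (\<Sum>k\<in>UNIV. T $ (i, k) $ (k, j))"
    by (subst sum.swap) simp
  finally show ?thesis .
qed

lemma mat_mult_tensor: "mat_mult (tensor X Y) = X ** Y"
  by (simp add: vec_eq_iff mat_mult_nth tensor_def matrix_matrix_mult_def)

lemma tr_inner_eq:
  "tr_inner X (Y :: 'n::finite cmat) =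
     (\<Sum>i\<in>UNIV. \<Sum>j\<in>UNIV. cnj (X $ i $ j) * Y $ i $ j) / of_nat CARD('n)"
  unfolding tr_inner_def ntr_def trace_def cadj_def matrix_matrix_mult_def
  by (subst sum.swap) (simp add: transpose_def)

lemma tr_inner_munit: "tr_inner (munit i j) (Y :: 'n::finite cmat) = Y $ i $ j / of_nat CARD('n)"
proof -
  have "(\<Sum>a\<in>UNIV. \<Sum>b\<in>UNIV. cnj (munit i j $ a $ b) * Y $ a $ b) =
      (\<Sum>a\<in>UNIV. \<Sum>b\<in>UNIV. if b = j then if a = i then Y $ a $ b else 0 else 0)"
    by (intro sum.cong refl) (auto simp: munit_nth)
  then show ?thesis by (simp add: tr_inner_eq)
qed

lemma tr_adjoint_eqI:
  assumes "\<And>X Y. tr_inner (F X) Y = tr_inner X (G Y)"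
  shows "tr_adjoint F = G"
  unfolding tr_adjoint_def
proof (rule the_equality)
  show "\<forall>X Y. tr_inner (F X) Y = tr_inner X (G Y)" using assms by blast
next
  fix H assume "\<forall>X Y. tr_inner (F X) Y = tr_inner X (H Y)"
  with assms have "tr_inner (munit i j) (H Y) = tr_inner (munit i j) (G Y)" for i j Y by metis
  then show "H = G" by (simp add: tr_inner_munit fun_eq_iff vec_eq_iff)
qed

lemma mat_comult_eq:
  "mat_comult (Y :: 'n::finite cmat) =
     (\<chi> p q. if snd p = fst q then of_nat CARD('n) * Y $ fst p $ snd q else 0)"
proof -
  have "tr_inner (mat_mult X) Y =
      tr_inner X (\<chi> p q. if snd p = fst q then of_nat CARD('n) * Y $ fst p $ snd q else 0)"
    for X and Y :: "'n cmat"
  proof -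
    have "(\<Sum>p\<in>UNIV. \<Sum>q\<in>UNIV. cnj (X $ p $ q) *
          (if snd p = fst q then of_nat CARD('n) * Y $ fst p $ snd q else 0)) =
        (\<Sum>a\<in>UNIV. \<Sum>k\<in>UNIV. \<Sum>l\<in>UNIV. \<Sum>b\<in>UNIV. if l = k then
          of_nat CARD('n) * (cnj (X $ (a, k) $ (k, b)) * Y $ a $ b) else 0)"
      by (auto simp: UNIV_Times_UNIV[symmetric] sum.cartesian_product' case_prod_beta
          intro!: sum.cong simp del: UNIV_Times_UNIV)
    also have "\<dots> = (\<Sum>a\<in>UNIV. \<Sum>k\<in>UNIV. \<Sum>b\<in>UNIV.
          of_nat CARD('n) * (cnj (X $ (a, k) $ (k, b)) * Y $ a $ b))"
    proof (rule sum.cong[OF refl], rule sum.cong[OF refl])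
      fix a k :: 'n
      show "(\<Sum>l\<in>UNIV. \<Sum>b\<in>UNIV. if l = k then
            of_nat CARD('n) * (cnj (X $ (a, k) $ (k, b)) * Y $ a $ b) else 0) =
          (\<Sum>b\<in>UNIV. of_nat CARD('n) * (cnj (X $ (a, k) $ (k, b)) * Y $ a $ b))"
        by (subst sum.swap) simp
    qed
    also have "\<dots> = of_nat CARD('n) *
        (\<Sum>a\<in>UNIV. \<Sum>b\<in>UNIV. cnj (mat_mult X $ a $ b) * Y $ a $ b)"
      unfolding mat_mult_nth cnj_sum sum_distrib_left sum_distrib_right
      by (rule sum.cong[OF refl], rule sum.swap)
    finally show ?thesis by (simp add: tr_inner_eq)
  qed
  then have "mat_comult = (\<lambda>Y :: 'n cmat. \<chi> p q.
      if snd p = fst q then of_nat CARD('n) * Y $ fst p $ snd q else 0)"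
    unfolding mat_comult_def by (rule tr_adjoint_eqI)
  from fun_cong[OF this, of Y] show ?thesis .
qed

lemma mat_comult_adapted_unit:
  "mat_comult (adapted_unit i j :: 'n::finite cmat) =
     (\<Sum>k\<in>UNIV. tensor (adapted_unit i k) (adapted_unit k j))"
proof -
  have "(\<Sum>k\<in>UNIV. tensor (adapted_unit i k) (adapted_unit k j)) $ (a, b) $ (c, d) =
      (\<Sum>k\<in>UNIV. if k = c then if i = a \<and> b = c \<and> j = d
        then of_nat CARD('n) * of_nat CARD('n) else 0 else (0 :: complex))" for a b c d
    unfolding sum_component
    by (intro sum.cong refl) (auto simp: tensor_def adapted_unit_eq munit_nth)
  then show ?thesis
    by (auto simp: vec_eq_iff mat_comult_eq adapted_unit_eq munit_nth)
qed

lemma dephasing_adapted_unit: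
  "dephasing (adapted_unit i j :: 'n::finite cmat) =
     (if i = j then cscale (ntr (munit i i) * of_nat CARD('n) ^ 2) (adapted_unit i i) else 0)"
  by (auto simp: vec_eq_iff dephasing_def adapted_unit_eq ntr_munit munit_nth
      power2_eq_square)

section \<open>Local quantum Cuntz--Krieger families on \<open>(M\<^sub>n, tr)\<close>\<close>

definition linear_into :: "'u cstar \<Rightarrow> ('n::finite cmat \<Rightarrow> 'u) \<Rightarrow> bool" where
  "linear_into C S \<longleftrightarrow> (\<forall>X. S X \<in> carrier C) \<and>
     (\<forall>X Y. S (X + Y) = S X \<oplus>\<^bsub>C\<^esub> S Y) \<and> (\<forall>c X. S (cscale c X) = c \<odot>\<^bsub>C\<^esub> S X)"

definition star_map :: "'u cstar \<Rightarrow> ('n::finite cmat \<Rightarrow> 'u) \<Rightarrow> 'n cmat \<Rightarrow> 'u" where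
  "star_map C S X = star C (S (cadj X))"

text \<open>Here \<open>\<delta> = n\<close>.\<close>

definition local_QCK_family ::
  "'u cstar \<Rightarrow> ('n::finite cmat \<Rightarrow> 'n cmat) \<Rightarrow> ('n cmat \<Rightarrow> 'u) \<Rightarrow> bool" where
  "local_QCK_family C A S \<longleftrightarrow> linear_into C S \<and>
     (\<forall>T. mult_tensor_map C (mult_tensor_map C S (star_map C S)) S (tensor_map mat_comult id T)
        = inverse (of_nat CARD('n) ^ 2) \<odot>\<^bsub>C\<^esub> S (mat_mult T)) \<and>
     (\<forall>T. mult_tensor_map C (star_map C S) S T
        = inverse (of_nat CARD('n) ^ 2) \<odot>\<^bsub>C\<^esub>
            mult_tensor_map C S (star_map C S) (mat_comult (A (mat_mult T)))) \<and>
     mult_tensor_map C S (star_map C S) (mat_comult (mat 1))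
        = inverse (of_nat CARD('n) ^ 2) \<odot>\<^bsub>C\<^esub> \<one>\<^bsub>C\<^esub>"

definition universal_local_QCK_family ::
  "'u cstar \<Rightarrow> ('n::finite cmat \<Rightarrow> 'n cmat) \<Rightarrow> ('n cmat \<Rightarrow> 'u) \<Rightarrow> bool" where
  "universal_local_QCK_family C A s \<longleftrightarrow> cstar_algebra C \<and> local_QCK_family C A s \<and>
     (\<forall>(E :: 'u cstar) S. cstar_algebra E \<and> local_QCK_family E A S \<longrightarrow>
        (\<exists>\<rho>. star_hom (cstar_generated C (range s)) (cstar_generated E (range S)) \<rho> \<and>
           \<rho> ` carrier (cstar_generated C (range s)) = carrier (cstar_generated E (range S)) \<and>
           \<rho> \<circ> s = S))"

end

theory Submission
  imports Defs
begin

text \<open>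
  In the rescaled images \<open>t i j\<close> of the adapted matrix units the three axioms of a local quantum
  Cuntz--Krieger family of the dephasing graph say, with \<open>P i j = (\<Sum>r. t i r * (t j r)\<^sup>*)\<close>, that
  \<open>P i j * t k l = \<delta>\<^sub>j\<^sub>k t i l\<close>, that \<open>(t j i)\<^sup>* * t k l = \<delta>\<^sub>j\<^sub>k \<delta>\<^sub>i\<^sub>l P i i\<close>, and that
  \<open>(\<Sum>i. P i i) = 1\<close> (lemma \<open>local_QCK_family_iff\<close>). Families \<open>t\<close> with these relations correspond
  to Cuntz isometries by \<open>V i = (\<Sum>j. t i j)\<close> and \<open>t i j = V i * V j * (V j)\<^sup>*\<close>: the elements \<open>P i i\<close>
  are orthogonal projections with sum \<open>1\<close> and \<open>t i j\<close> is a partial isometry from \<open>P j j\<close> into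
  \<open>P i i\<close>, the restriction of \<open>V i\<close> to the range of \<open>V j\<close> (lemmas \<open>local_relations_imp_cuntz\<close> and
  \<open>cuntz_imp_local_relations\<close>). So \<open>V\<close> and \<open>s\<close> generate the same algebra \<open>LO\<close>.

  For the isomorphism with a Cuntz algebra \<open>Q\<close>, the isometries of \<open>Q\<close> define a family there, so
  universality of \<open>s\<close> gives a surjection \<open>\<rho>\<close> from \<open>LO\<close> to \<open>Q\<close> which sends \<open>V i\<close> to the \<open>i\<close>-th
  isometry. Universality of \<open>Q\<close> gives \<open>\<phi>\<close> in the other direction. The composition \<open>\<phi> \<circ> \<rho>\<close> fixes the
  generators \<open>V i\<close>, so it is the identity and \<open>\<rho>\<close> is injective.

  Two facts from the theory of C*-algebras enter, and both are given proofs without spectral theory.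
  Isometries whose range projections sum to \<open>1\<close> have orthogonal ranges
  (lemma \<open>cuntz_isometries_orthogonal\<close>); this rests on the unit being an extreme point of the unit ball,
  in the form that a self-adjoint \<open>z\<close> with \<open>\<parallel>1 + z\<parallel> \<le> 1\<close> and \<open>\<parallel>1 - z\<parallel> \<le> 1\<close> vanishes
  (lemma \<open>one_extreme_selfadjoint\<close>). And *-homomorphisms are contractive
  (lemma \<open>star_hom_contractive\<close>), which makes the fixed points of \<open>\<phi> \<circ> \<rho>\<close> a closed set; this rests on
  a square root of \<open>1 - h\<^sup>2\<close> for self-adjoint \<open>h\<close> of norm less than \<open>1\<close>, obtained as a fixed point
  (lemma \<open>sqrt_one_minus_square\<close>).
\<close>

section \<open>Algebra and norm in a C*-algebra\<close>

context pre_cstar_algebra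
begin

lemma scalar_closed [simp]: "c \<in> carrier complex_ring"
  by (simp add: complex_ring_def)

lemma smult_closed [simp, intro]: "x \<in> carrier A \<Longrightarrow> c \<odot> x \<in> carrier A"
  by (simp add: scalar.smult_closed)

lemma smult_add_left: "x \<in> carrier A \<Longrightarrow> (a + b) \<odot> x = a \<odot> x \<oplus> b \<odot> x"
  using scalar.smult_l_distr[of a b x] by (simp add: complex_ring_def)

lemma smult_add_right:
  "x \<in> carrier A \<Longrightarrow> y \<in> carrier A \<Longrightarrow> a \<odot> (x \<oplus> y) = a \<odot> x \<oplus> a \<odot> y"
  by (simp add: scalar.smult_r_distr)

lemma smult_smult [simp]: "x \<in> carrier A \<Longrightarrow> a \<odot> (b \<odot> x) = (a * b) \<odot> x"
  using scalar.smult_assoc1[of a b x] by (simp add: complex_ring_def)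

lemma one_smult [simp]: "x \<in> carrier A \<Longrightarrow> 1 \<odot> x = x"
  using scalar.smult_one[of x] by (simp add: complex_ring_def)

lemma zero_smult [simp]: "x \<in> carrier A \<Longrightarrow> 0 \<odot> x = \<zero>"
  using scalar.smult_l_null[of x] by (simp add: complex_ring_def)

lemma smult_zero [simp]: "c \<odot> \<zero> = \<zero>"
  by (simp add: scalar.smult_r_null)

lemma minus_one_smult: "x \<in> carrier A \<Longrightarrow> (-1) \<odot> x = \<ominus> x"
  using smult_add_left[of x 1 "-1"] by (metis add.inv_equality add.inv_inv one_smult
      smult_closed minus_equality a_comm neg_eq_iff_add_eq_0 zero_smult)

lemma minus_eq_smult: "x \<in> carrier A \<Longrightarrow> y \<in> carrier A \<Longrightarrow> x \<ominus> y = x \<oplus> (-1) \<odot> y"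
  by (simp add: a_minus_def minus_one_smult)

declare star_closed [simp, intro]

lemmas star_simps = star_star star_add star_smult star_mult

lemma star_zero [simp]: "star A \<zero> = \<zero>"
  using star_smult[of \<zero> 0] by simp

lemma star_one [simp]: "star A \<one> = \<one>"
  by (metis l_one one_closed r_one star_closed star_mult star_star)

lemma star_minus:
  "x \<in> carrier A \<Longrightarrow> y \<in> carrier A \<Longrightarrow> star A (x \<ominus> y) = star A x \<ominus> star A y"
  by (simp add: minus_eq_smult star_simps)

lemma finsum_in_carrier [simp]: "(\<And>i. i \<in> I \<Longrightarrow> f i \<in> carrier A) \<Longrightarrow> finsum A f I \<in> carrier A"
  by (simp add: Pi_def finsum_closed)

lemma star_finsum:
  assumes "finite I" "\<And>i. i \<in> I \<Longrightarrow> f i \<in> carrier A"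
  shows "star A (finsum A f I) = (\<Oplus>i\<in>I. star A (f i))"
  using assms by (induction I rule: finite_induct) (auto simp: Pi_def star_simps)

lemma smult_finsum:
  assumes "finite I" "\<And>i. i \<in> I \<Longrightarrow> f i \<in> carrier A"
  shows "c \<odot> finsum A f I = (\<Oplus>i\<in>I. c \<odot> f i)"
  using assms by (simp add: scalar.finsum_smult_ldistr Pi_def)

lemma cnorm_zero [simp]: "cnorm A \<zero> = 0"
  by (simp add: cnorm_eq_0)

lemma cnorm_finsum_le:
  assumes "finite I" "\<And>i. i \<in> I \<Longrightarrow> f i \<in> carrier A"
  shows "cnorm A (finsum A f I) \<le> (\<Sum>i\<in>I. cnorm A (f i))"
  using assms
proof (induction I rule: finite_induct)
  case (insert i I)
  then have "cnorm A (finsum A f (insert i I)) \<le> cnorm A (f i) + cnorm A (finsum A f I)"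
    by (simp add: Pi_def cnorm_triangle)
  with insert show ?case by simp
qed simp

lemma cnorm_minus_commute:
  assumes "x \<in> carrier A" "y \<in> carrier A"
  shows "cnorm A (x \<ominus> y) = cnorm A (y \<ominus> x)"
proof -
  have "y \<ominus> x = (-1) \<odot> (x \<ominus> y)"
    using assms by (simp add: minus_eq_smult smult_add_right a_comm)
  with assms show ?thesis by (simp add: cnorm_smult)
qed

lemma cnorm_minus_le:
  assumes "x \<in> carrier A" "y \<in> carrier A"
  shows "cnorm A (x \<ominus> y) \<le> cnorm A x + cnorm A y"
  using cnorm_triangle[of x "(-1) \<odot> y"] assms by (simp add: minus_eq_smult cnorm_smult)

lemma cnorm_le_minus_add:
  assumes "x \<in> carrier A" "y \<in> carrier A"
  shows "cnorm A x \<le> cnorm A (x \<ominus> y) + cnorm A y"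
proof -
  have "x = (x \<ominus> y) \<oplus> y" using assms by algebra
  then show ?thesis using assms cnorm_triangle[of "x \<ominus> y" y] by simp
qed

lemma cnorm_minus_triangle:
  assumes "x \<in> carrier A" "y \<in> carrier A" "z \<in> carrier A"
  shows "cnorm A (x \<ominus> z) \<le> cnorm A (x \<ominus> y) + cnorm A (y \<ominus> z)"
proof -
  have "x \<ominus> z = (x \<ominus> y) \<oplus> (y \<ominus> z)" using assms by algebra
  then show ?thesis using assms by (simp add: cnorm_triangle)
qed

lemma minus_eq_zero_iff:
  assumes "x \<in> carrier A" "y \<in> carrier A"
  shows "x \<ominus> y = \<zero> \<longleftrightarrow> x = y"
  using assms by (metis add.inv_closed minus_equality minus_minus a_minus_def r_neg a_comm)

lemma cnorm_star [simp]:
  assumes x: "x \<in> carrier A"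
  shows "cnorm A (star A x) = cnorm A x"
proof -
  have le: "cnorm A y \<le> cnorm A (star A y)" if y: "y \<in> carrier A" for y
  proof (cases "cnorm A y = 0")
    case False
    have "cnorm A y * cnorm A y \<le> cnorm A (star A y) * cnorm A y"
      using cnorm_mult[of "star A y" y] cstar_identity[OF y] y by (simp add: power2_eq_square)
    with False cnorm_nonneg[OF y] show ?thesis by simp
  qed (use y in \<open>simp add: cnorm_nonneg\<close>)
  show ?thesis using le[OF x] le[of "star A x"] x by (simp add: star_star)
qed

lemma cnorm_projection_le_1:
  assumes "p \<in> carrier A" "star A p \<otimes> p = p"
  shows "cnorm A p \<le> 1"
proof -
  have "cnorm A p = cnorm A p * cnorm A p"
    using cstar_identity[of p] assms by (simp add: power2_eq_square)
  then show ?thesis by (metis mult_cancel_right2 order.refl zero_le_one)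
qed

lemma cnorm_one_le_1: "cnorm A \<one> \<le> 1"
  by (rule cnorm_projection_le_1) auto

lemma cnorm_le_1I:
  assumes "x \<in> carrier A" "cnorm A (star A x \<otimes> x) \<le> 1"
  shows "cnorm A x \<le> 1"
  using assms cstar_identity[of x] cnorm_nonneg[of x] by (simp add: power_le_one_iff)

lemma eq_zero_if_star_mult_self:
  assumes "x \<in> carrier A" "star A x \<otimes> x = \<zero>"
  shows "x = \<zero>"
  using cstar_identity[of x] assms by (simp add: cnorm_eq_0)

lemma cnorm_mult_le_1:
  assumes "x \<in> carrier A" "y \<in> carrier A" "cnorm A x \<le> 1" "cnorm A y \<le> 1"
  shows "cnorm A (x \<otimes> y) \<le> 1"
  using cnorm_mult[of x y] mult_le_one[of "cnorm A x" "cnorm A y"] cnorm_nonneg[of y] assms by auto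

lemma cnorm_convex_le_1:
  assumes "x \<in> carrier A" "y \<in> carrier A" "cnorm A x \<le> 1" "cnorm A y \<le> 1" "0 \<le> a" "a \<le> 1"
  shows "cnorm A (complex_of_real a \<odot> x \<oplus> complex_of_real (1 - a) \<odot> y) \<le> 1"
proof -
  have "cnorm A (complex_of_real a \<odot> x \<oplus> complex_of_real (1 - a) \<odot> y)
      \<le> a * cnorm A x + (1 - a) * cnorm A y"
    using assms by (intro order.trans[OF cnorm_triangle])
      (simp_all add: cnorm_smult del: of_real_diff)
  also have "\<dots> \<le> a * 1 + (1 - a) * 1"
    using assms by (intro add_mono mult_left_mono) auto
  finally show ?thesis by simp
qed

section \<open>The unit is an extreme point of the unit ball\<close>

text \<open>
  Polynomials of degree at most \<open>2\<close> in \<open>z\<close>, in coordinates: identities between them reduce to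
  identities between their complex coefficients.
\<close>

definition quad :: "'u \<Rightarrow> complex \<Rightarrow> complex \<Rightarrow> complex \<Rightarrow> 'u" where
  "quad z a b c = a \<odot> \<one> \<oplus> (b \<odot> z \<oplus> c \<odot> (z \<otimes> z))"

context
  fixes z assumes z [simp]: "z \<in> carrier A"
begin

lemma quad_closed [simp]: "quad z a b c \<in> carrier A"
  by (simp add: quad_def)

lemma quad_add: "quad z a b c \<oplus> quad z a' b' c' = quad z (a + a') (b + b') (c + c')"
  by (simp add: quad_def smult_add_left a_ac)

lemma quad_smult: "k \<odot> quad z a b c = quad z (k * a) (k * b) (k * c)"
  by (simp add: quad_def smult_add_right)

lemma quad_mult: "quad z a b 0 \<otimes> quad z a' b' 0 = quad z (a * a') (a * b' + b * a') (b * b')"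
  by (simp add: quad_def l_distr r_distr smult_mult_left smult_mult_right smult_add_left
      smult_add_right a_ac mult.commute)

lemma star_quad: "star A z = z \<Longrightarrow> star A (quad z a b c) = quad z (cnj a) (cnj b) (cnj c)"
  by (simp add: quad_def star_simps)

end

text \<open>
  Scaling step for the extreme point argument below. Averaging \<open>(\<one> \<oplus> z)\<^sup>2\<close> and \<open>(\<one> \<ominus> z)\<^sup>2\<close>
  gives \<open>1 + z\<^sup>2\<close>, and a convex combination of this with \<open>(1 + z)\<^sup>2\<close> is \<open>1 + sqrt 2 z + z\<^sup>2\<close>. The
  latter is \<open>X\<^sup>* X\<close> for \<open>X = 1 + \<zeta> z\<close>, where \<open>\<zeta>\<close> is the primitive eighth root of unity in the first
  quadrant, so the C*-identity bounds \<open>X\<close>. Since \<open>\<zeta>\<^sup>2\<close> is purely imaginary, the quadratic terms of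
  \<open>X\<^sup>2\<close> and of its adjoint cancel, and half their sum is \<open>1 + sqrt 2 z\<close>.
\<close>

lemma cnorm_quad_sqrt2:
  assumes z: "z \<in> carrier A" "star A z = z"
    and pm: "cnorm A (quad z 1 1 0) \<le> 1" "cnorm A (quad z 1 (-1) 0) \<le> 1"
  shows "cnorm A (quad z 1 (sqrt 2) 0) \<le> 1"
proof -
  define a where "a = 1 / sqrt 2"
  have ra: "a * 2 = sqrt 2" "2 * (a * a) = 1"
    by (simp_all add: a_def real_div_sqrt)
  have a: "0 \<le> a" "a \<le> 1" "2 * (complex_of_real a * complex_of_real a) = 1"
    "complex_of_real a * 2 = sqrt 2"
  proof -
    show "0 \<le> a" "a \<le> 1" by (simp_all add: a_def)
    show "2 * (complex_of_real a * complex_of_real a) = 1" "complex_of_real a * 2 = sqrt 2"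
      using ra[THEN arg_cong, of complex_of_real] by (simp_all only: of_real_mult of_real_numeral of_real_1)
  qed
  define \<zeta> where "\<zeta> = Complex a a"
  have \<zeta>: "cnj \<zeta> * \<zeta> = 1" "\<zeta> + cnj \<zeta> = sqrt 2" "cnj \<zeta> * cnj \<zeta> + \<zeta> * \<zeta> = 0"
    using a(3) a(4) unfolding \<zeta>_def by (auto simp: complex_eq_iff)
  have sq: "cnorm A (quad z 1 2 1) \<le> 1" "cnorm A (quad z 1 (-2) 1) \<le> 1"
    using cnorm_mult_le_1[OF _ _ pm(1) pm(1)] cnorm_mult_le_1[OF _ _ pm(2) pm(2)]
    by (simp_all add: quad_mult[OF z(1)] z)
  have "cnorm A (quad z 1 0 1) \<le> 1"
    using cnorm_convex_le_1[OF _ _ sq, of "1/2"] z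
    by (simp add: quad_smult quad_add)
  from cnorm_convex_le_1[OF _ _ sq(1) this, of a] z a
  have "cnorm A (quad z 1 (sqrt 2) 1) \<le> 1"
    by (simp add: quad_smult quad_add)
  then have X: "cnorm A (quad z 1 \<zeta> 0) \<le> 1"
    using z \<zeta> by - (rule cnorm_le_1I, simp_all add: star_quad quad_mult)
  then have X': "cnorm A (quad z 1 (cnj \<zeta>) 0) \<le> 1"
    using cnorm_star[of "quad z 1 \<zeta> 0"] z by (simp add: star_quad)
  have "cnorm A (complex_of_real (1/2) \<odot> (quad z 1 \<zeta> 0 \<otimes> quad z 1 \<zeta> 0) \<oplus>
        complex_of_real (1 - 1/2) \<odot> (quad z 1 (cnj \<zeta>) 0 \<otimes> quad z 1 (cnj \<zeta>) 0)) \<le> 1"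
    using z X X' by (intro cnorm_convex_le_1 cnorm_mult_le_1) auto
  moreover have "complex_of_real (1/2) \<odot> (quad z 1 \<zeta> 0 \<otimes> quad z 1 \<zeta> 0) \<oplus>
        complex_of_real (1 - 1/2) \<odot> (quad z 1 (cnj \<zeta>) 0 \<otimes> quad z 1 (cnj \<zeta>) 0)
      = quad z 1 (sqrt 2) 0"
  proof -
    have h: "complex_of_real (1/2) = 1/2" "complex_of_real (1 - 1/2) = 1/2" by simp_all
    have "1/2 * (1 * \<zeta> + \<zeta> * 1) + 1/2 * (1 * cnj \<zeta> + cnj \<zeta> * 1) = complex_of_real (sqrt 2)"
      using \<zeta>(2) by (simp add: algebra_simps)
    moreover have "1/2 * (\<zeta> * \<zeta>) + 1/2 * (cnj \<zeta> * cnj \<zeta>) = 0"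
      using \<zeta>(3) by (simp add: add.commute flip: add_divide_distrib)
    moreover have "1/2 * (1 * 1) + 1/2 * (1 * 1) = (1 :: complex)" by simp
    ultimately show ?thesis by (simp only: quad_mult[OF z(1)] quad_smult[OF z(1)] quad_add[OF z(1)] h)
  qed
  ultimately show ?thesis by simp
qed

text \<open>
  Iterating the previous step bounds \<open>1 + c z\<close> for arbitrarily large \<open>c\<close>. In terms of spectral
  theory, the spectrum of \<open>z\<close> is real and contained in both \<open>{-2..0}\<close> and \<open>{0..2}\<close>; the argument
  replaces the functional calculus.
\<close>

lemma one_extreme_selfadjoint:
  assumes z: "z \<in> carrier A" "star A z = z"
    and pm: "cnorm A (\<one> \<oplus> z) \<le> 1" "cnorm A (\<one> \<ominus> z) \<le> 1"
  shows "z = \<zero>"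
proof -
  define r :: "nat \<Rightarrow> complex" where "r k = complex_of_real (sqrt 2 ^ k)" for k
  have "cnorm A (quad z 1 (r k) 0) \<le> 1 \<and> cnorm A (quad z 1 (- r k) 0) \<le> 1" for k
  proof (induction k)
    case 0
    then show ?case using pm z by (simp add: quad_def r_def minus_eq_smult)
  next
    case (Suc k)
    have sc: "quad z 1 (b * c) 0 = quad (c \<odot> z) 1 b 0" for b c
      using z by (simp add: quad_def smult_mult_left smult_mult_right)
    have "star A (r k \<odot> z) = r k \<odot> z" "star A ((- r k) \<odot> z) = (- r k) \<odot> z"
      using z by (auto simp: star_smult r_def)
    then show ?case
      using Suc cnorm_quad_sqrt2[of "r k \<odot> z"] cnorm_quad_sqrt2[of "(- r k) \<odot> z"] z
      by (simp add: sc[symmetric] r_def)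
  qed
  then have b: "sqrt 2 ^ k * cnorm A z \<le> 2" for k
  proof -
    assume *: "\<And>k. cnorm A (quad z 1 (r k) 0) \<le> 1 \<and> cnorm A (quad z 1 (- r k) 0) \<le> 1"
    have "r k \<odot> z = quad z 1 (r k) 0 \<ominus> \<one>"
    proof -
      have "(\<one> \<oplus> w) \<ominus> \<one> = w" if "w \<in> carrier A" for w
        using that by algebra
      from this[of "r k \<odot> z"] z show ?thesis by (simp add: quad_def)
    qed
    then have "cnorm A (r k \<odot> z) \<le> cnorm A (quad z 1 (r k) 0) + cnorm A \<one>"
      using z by (simp add: cnorm_minus_le)
    with *[of k] cnorm_one_le_1 z show ?thesis by (simp add: cnorm_smult r_def norm_power)
  qed
  have "cnorm A z = 0"
  proof (rule ccontr)
    assume "cnorm A z \<noteq> 0"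
    then have "0 < cnorm A z" using cnorm_nonneg z by (simp add: less_le)
    moreover obtain k where "2 / cnorm A z < sqrt 2 ^ k"
      using real_arch_pow[of "sqrt 2"] by auto
    ultimately show False using b[of k] by (simp add: field_simps)
  qed
  then show ?thesis using z by (simp add: cnorm_eq_0)
qed

end


context pre_cstar_algebra
begin

section \<open>Limits of sequences\<close>

definition tends :: "(nat \<Rightarrow> 'u) \<Rightarrow> 'u \<Rightarrow> bool" where
  "tends \<sigma> l \<longleftrightarrow> range \<sigma> \<subseteq> carrier A \<and> l \<in> carrier A \<and> (\<lambda>n. cnorm A (\<sigma> n \<ominus> l)) \<longlonglongrightarrow> 0"

text \<open>
  \<open>F\<close> only has to be Lipschitz between the limit and the members of the sequence, since in the
  fixed point iteration below \<open>F\<close> is a contraction on a ball only.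
\<close>

lemma tends_lipschitz:
  assumes "tends \<sigma> l" "range (\<lambda>n. F (\<sigma> n)) \<subseteq> carrier A" "F l \<in> carrier A"
    and "\<And>n. cnorm A (F (\<sigma> n) \<ominus> F l) \<le> K * cnorm A (\<sigma> n \<ominus> l)"
  shows "tends (\<lambda>n. F (\<sigma> n)) (F l)"
proof -
  have "(\<lambda>n. K * cnorm A (\<sigma> n \<ominus> l)) \<longlonglongrightarrow> K * 0"
    using assms(1) unfolding tends_def by (intro tendsto_mult_left) auto
  then have "(\<lambda>n. cnorm A (F (\<sigma> n) \<ominus> F l)) \<longlonglongrightarrow> 0"
    using assms
    by - (rule tendsto_sandwich[of "\<lambda>_. 0" _ _ "\<lambda>n. K * cnorm A (\<sigma> n \<ominus> l)"];
      auto simp: tends_def intro!: always_eventually cnorm_nonneg)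
  with assms show ?thesis by (auto simp: tends_def)
qed

lemma tends_unique:
  assumes "tends \<sigma> l" "tends \<sigma> l'"
  shows "l = l'"
proof -
  have "(\<lambda>n. cnorm A (\<sigma> n \<ominus> l) + cnorm A (\<sigma> n \<ominus> l')) \<longlonglongrightarrow> 0 + 0"
    using assms unfolding tends_def by (intro tendsto_add) auto
  moreover have "cnorm A (l \<ominus> l') \<le> cnorm A (\<sigma> n \<ominus> l) + cnorm A (\<sigma> n \<ominus> l')" for n
    using cnorm_minus_triangle[of l "\<sigma> n" l'] cnorm_minus_commute[of l "\<sigma> n"] assms
    by (auto simp: tends_def)
  ultimately have "cnorm A (l \<ominus> l') \<le> 0 + 0"
    by (intro LIMSEQ_le_const) auto
  then have "cnorm A (l \<ominus> l') = 0"
    using assms by (intro antisym cnorm_nonneg) (auto simp: tends_def)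
  with assms show ?thesis by (simp add: tends_def cnorm_eq_0 minus_eq_zero_iff)
qed

lemma closedin_iff_tends:
  assumes "X \<subseteq> carrier A"
  shows "closedin (Metric_space.mtopology (carrier A) (cdist A)) X \<longleftrightarrow>
    (\<forall>\<sigma> l. range \<sigma> \<subseteq> X \<and> tends \<sigma> l \<longrightarrow> l \<in> X)"
proof -
  interpret M: Metric_space "carrier A" "cdist A" by (rule Metric_space_cdist)
  have "limitin M.mtopology \<sigma> l sequentially \<longleftrightarrow> tends \<sigma> l" if "range \<sigma> \<subseteq> X" for \<sigma> l
  proof -
    have "\<sigma> n \<in> carrier A" for n using that assms by auto
    then show ?thesis
      by (auto simp: M.limit_metric_sequentially tends_def LIMSEQ_iff cdist_def cnorm_nonneg)
  qed
  with assms show ?thesis unfolding M.metric_closedin_iff_sequentially_closed by blast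
qed

lemma mcomplete_iff_tends:
  "Metric_space.mcomplete (carrier A) (cdist A) \<longleftrightarrow>
    (\<forall>\<sigma>. range \<sigma> \<subseteq> carrier A \<and>
        (\<forall>\<epsilon>>0. \<exists>N. \<forall>n\<ge>N. \<forall>n'\<ge>N. cnorm A (\<sigma> n \<ominus> \<sigma> n') < \<epsilon>) \<longrightarrow> (\<exists>l. tends \<sigma> l))"
proof -
  interpret M: Metric_space "carrier A" "cdist A" by (rule Metric_space_cdist)
  have lim: "limitin M.mtopology \<sigma> l sequentially \<longleftrightarrow> tends \<sigma> l" if "range \<sigma> \<subseteq> carrier A" for \<sigma> l
  proof -
    have "\<sigma> n \<in> carrier A" for n using that by auto
    then show ?thesis
      by (auto simp: M.limit_metric_sequentially tends_def LIMSEQ_iff cdist_def cnorm_nonneg)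
  qed
  have "M.MCauchy \<sigma> \<longleftrightarrow> range \<sigma> \<subseteq> carrier A \<and>
      (\<forall>\<epsilon>>0. \<exists>N. \<forall>n\<ge>N. \<forall>n'\<ge>N. cnorm A (\<sigma> n \<ominus> \<sigma> n') < \<epsilon>)" for \<sigma>
  proof (cases "range \<sigma> \<subseteq> carrier A")
    case True
    then have "\<sigma> n \<in> carrier A" for n by auto
    then show ?thesis by (auto simp: M.MCauchy_def cdist_def)
  qed (simp add: M.MCauchy_def)
  then show ?thesis unfolding M.mcomplete_def by (simp add: lim cong: imp_cong conj_cong)
qed

text \<open>
  If \<open>k\<close> and \<open>g\<close> commute, then \<open>u = k + i g\<close> satisfies \<open>u\<^sup>* u = k\<^sup>2 + g\<^sup>2\<close>, so \<open>u\<close> is a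
  contraction, and \<open>k\<close> is the mean of \<open>u\<close> and its adjoint.
\<close>

lemma cnorm_commuting_selfadjoint_le:
  assumes [simp]: "k \<in> carrier A" "g \<in> carrier A" and sa: "star A k = k" "star A g = g"
    and comm: "g \<otimes> k = k \<otimes> g" and le: "cnorm A (k \<otimes> k \<oplus> g \<otimes> g) \<le> 1"
  shows "cnorm A k \<le> 1"
proof -
  define u where "u = k \<oplus> \<i> \<odot> g"
  have u [simp]: "u \<in> carrier A" by (simp add: u_def)
  have su: "star A u = k \<oplus> (- \<i>) \<odot> g" by (simp add: u_def star_simps sa)
  have "star A u \<otimes> u = k \<otimes> k \<oplus> (\<i> \<odot> (k \<otimes> g) \<oplus> (- \<i>) \<odot> (k \<otimes> g)) \<oplus> g \<otimes> g"
    unfolding su by (simp add: u_def l_distr r_distr smult_mult_left smult_mult_right smult_add_right comm a_ac)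
  also have "\<i> \<odot> (k \<otimes> g) \<oplus> (- \<i>) \<odot> (k \<otimes> g) = \<zero>"
    by (simp flip: smult_add_left)
  finally have "cnorm A u \<le> 1" using le by (intro cnorm_le_1I[OF u]) simp
  moreover have "complex_of_real (1/2) \<odot> u \<oplus> complex_of_real (1 - 1/2) \<odot> star A u
      = (1/2 + 1/2) \<odot> k \<oplus> (\<i>/2 + (- \<i>/2)) \<odot> g"
    unfolding su unfolding u_def smult_add_left[OF assms(1)] smult_add_left[OF assms(2)]
    by (simp add: smult_add_right a_ac)
  then have "complex_of_real (1/2) \<odot> u \<oplus> complex_of_real (1 - 1/2) \<odot> star A u = k" by simp
  ultimately show ?thesis
    using cnorm_convex_le_1[of u "star A u" "1/2"] by simp
qed

end

section \<open>Square roots\<close>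

context cstar_algebra
begin

text \<open>
  The element \<open>1 - g\<close> is the solution \<open>y\<close> of \<open>2 y = h\<^sup>2 + y\<^sup>2\<close> in the ball of radius \<open>\<parallel>h\<parallel>\<^sup>2\<close>. The
  right-hand side divided by \<open>2\<close> is a contraction of that ball, and its iterates from \<open>0\<close> are
  self-adjoint and commute with \<open>h\<close>, properties that pass to the limit.
\<close>

lemma sqrt_one_minus_square:
  assumes h [simp]: "h \<in> carrier A" and sa: "star A h = h" and lt: "cnorm A h < 1"
  obtains g where "g \<in> carrier A" "star A g = g" "g \<otimes> h = h \<otimes> g" "h \<otimes> h \<oplus> g \<otimes> g = \<one>"
proof -
  define q where "q = (cnorm A h)\<^sup>2"
  have q: "0 \<le> q" "q < 1"
    using lt cnorm_nonneg[OF h] by (auto simp: q_def power_less_one_iff abs_square_less_1)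
  define F where "F y = (1/2) \<odot> (h \<otimes> h \<oplus> y \<otimes> y)" for y
  define y where "y n = (F ^^ n) \<zero>" for n
  have yS: "y (Suc n) = F (y n)" for n by (simp add: y_def)
  have F [simp]: "x \<in> carrier A \<Longrightarrow> F x \<in> carrier A" for x by (simp add: F_def)
  have yc [simp]: "y n \<in> carrier A" for n
    by (induction n) (simp_all add: yS, simp add: y_def)
  have F_le: "cnorm A (F x) \<le> q" if [simp]: "x \<in> carrier A" and "cnorm A x \<le> q" for x
  proof -
    have "cnorm A (x \<otimes> x) \<le> q * q"
      using that q cnorm_nonneg[of x] by (intro order.trans[OF cnorm_mult] mult_mono) auto
    also have "\<dots> \<le> q" using q by (simp add: mult_left_le)
    finally have "cnorm A (h \<otimes> h \<oplus> x \<otimes> x) \<le> q + q"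
      using cnorm_mult[OF h h] by (intro order.trans[OF cnorm_triangle] add_mono)
        (auto simp: q_def power2_eq_square)
    then show ?thesis by (simp add: F_def cnorm_smult)
  qed
  have y_le: "cnorm A (y n) \<le> q" for n
  proof (induction n)
    case 0
    then show ?case using q by (simp add: y_def)
  next
    case (Suc n)
    then show ?case by (simp add: yS F_le)
  qed
  have F_contr: "cnorm A (F b \<ominus> F c) \<le> q * cnorm A (b \<ominus> c)"
    if [simp]: "b \<in> carrier A" "c \<in> carrier A" and le: "cnorm A b \<le> q" "cnorm A c \<le> q" for b c
  proof -
    have "(h \<otimes> h \<oplus> b \<otimes> b) \<ominus> (h \<otimes> h \<oplus> c \<otimes> c) = b \<otimes> (b \<ominus> c) \<oplus> (b \<ominus> c) \<otimes> c"
    proof -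
      have "(s \<oplus> b \<otimes> b) \<ominus> (s \<oplus> c \<otimes> c) = b \<otimes> (b \<ominus> c) \<oplus> (b \<ominus> c) \<otimes> c"
        if "s \<in> carrier A" for s using that \<open>b \<in> carrier A\<close> \<open>c \<in> carrier A\<close> by algebra
      then show ?thesis by simp
    qed
    moreover have "F b \<ominus> F c = (1/2) \<odot> ((h \<otimes> h \<oplus> b \<otimes> b) \<ominus> (h \<otimes> h \<oplus> c \<otimes> c))"
      by (simp add: F_def minus_eq_smult smult_add_right)
    ultimately have "cnorm A (F b \<ominus> F c) \<le>
        1/2 * (cnorm A (b \<otimes> (b \<ominus> c)) + cnorm A ((b \<ominus> c) \<otimes> c))"
      by (simp add: cnorm_smult cnorm_triangle)
    also have "\<dots> \<le> 1/2 * (q * cnorm A (b \<ominus> c) + cnorm A (b \<ominus> c) * q)"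
      using le by (intro mult_left_mono add_mono order.trans[OF cnorm_mult] mult_mono)
        (auto simp: cnorm_nonneg q)
    finally show ?thesis by (simp add: mult.commute)
  qed
  \<comment> \<open>Applying the contraction \<open>n\<close> times to the pair \<open>y k\<close>, \<open>y 0\<close> gives a Cauchy sequence without
    summing a geometric series.\<close>
  have cauchy: "cnorm A (y (n + k) \<ominus> y n) \<le> q ^ n" for n k
  proof (induction n)
    case 0
    have "y 0 = \<zero>" by (simp add: y_def)
    then have "y k \<ominus> y 0 = y k" by (simp add: a_minus_def)
    then show ?case using y_le[of k] q by simp
  next
    case (Suc n)
    have "cnorm A (y (Suc n + k) \<ominus> y (Suc n)) \<le> q * cnorm A (y (n + k) \<ominus> y n)"
      by (simp add: yS F_contr y_le)
    also have "\<dots> \<le> q * q ^ n" using Suc q by (intro mult_left_mono) auto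
    finally show ?case by simp
  qed
  have "\<exists>N. \<forall>m\<ge>N. \<forall>n\<ge>N. cnorm A (y m \<ominus> y n) < \<epsilon>" if \<epsilon>: "\<epsilon> > 0" for \<epsilon>
  proof -
    obtain N where N: "q ^ N < \<epsilon>/2" using real_arch_pow_inv[of "\<epsilon>/2" q] q \<epsilon> by auto
    have "cnorm A (y m \<ominus> y n) < \<epsilon>" if "m \<ge> N" "n \<ge> N" for m n
      using cnorm_minus_triangle[of "y m" "y N" "y n"] cauchy[of N "m - N"] cauchy[of N "n - N"] N
        that cnorm_minus_commute[of "y N" "y n"] by simp
    then show ?thesis by blast
  qed
  then obtain l where l: "tends y l"
    using complete unfolding mcomplete_iff_tends by (metis image_subsetI yc)
  then have lc [simp]: "l \<in> carrier A" by (simp add: tends_def)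
  have "tends (\<lambda>n. y (Suc n)) l"
    using l LIMSEQ_Suc[of "\<lambda>n. cnorm A (y n \<ominus> l)"] by (auto simp: tends_def)
  moreover have "cnorm A l \<le> q"
  proof (rule LIMSEQ_le_const)
    show "(\<lambda>n. cnorm A (y n \<ominus> l) + q) \<longlonglongrightarrow> q"
      using l tendsto_add[OF _ tendsto_const[of q]] unfolding tends_def by force
    have "cnorm A l \<le> cnorm A (y n \<ominus> l) + q" for n
      using cnorm_le_minus_add[of l "y n"] y_le[of n] cnorm_minus_commute[of l "y n"] by simp
    then show "\<exists>N. \<forall>n\<ge>N. cnorm A l \<le> cnorm A (y n \<ominus> l) + q" by blast
  qed
  then have "tends (\<lambda>n. F (y n)) (F l)"
    using y_le by (intro tends_lipschitz[OF l, where F = F and K = q]) (auto intro!: F_contr)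
  ultimately have Fl: "F l = l" unfolding yS by (metis tends_unique)
  have "star A (y n) = y n \<and> y n \<otimes> h = h \<otimes> y n" for n
  proof (induction n)
    case 0
    then show ?case by (simp add: y_def)
  next
    case (Suc n)
    then show ?case
      by (simp add: yS F_def star_simps sa l_distr r_distr smult_mult_left smult_mult_right)
        (metis h m_assoc yc)
  qed
  then have y: "star A (y n) = y n" "y n \<otimes> h = h \<otimes> y n" for n by auto
  have "tends (\<lambda>n. star A (y n)) (star A l)"
    by (intro tends_lipschitz[OF l, where F = "star A" and K = 1]) (auto simp flip: star_minus)
  then have sl: "star A l = l" using l by (simp add: y(1)) (metis tends_unique)
  have "tends (\<lambda>n. y n \<otimes> h) (l \<otimes> h)"
  proof (rule tends_lipschitz[OF l, where K = "cnorm A h"])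
    have "y n \<otimes> h \<ominus> l \<otimes> h = (y n \<ominus> l) \<otimes> h" for n
      by (simp add: minus_eq_smult l_distr smult_mult_left)
    then show "cnorm A (y n \<otimes> h \<ominus> l \<otimes> h) \<le> cnorm A h * cnorm A (y n \<ominus> l)" for n
      using cnorm_mult[of "y n \<ominus> l" h] by (simp add: mult.commute)
  qed auto
  moreover have "tends (\<lambda>n. h \<otimes> y n) (h \<otimes> l)"
  proof (rule tends_lipschitz[OF l, where K = "cnorm A h"])
    have "h \<otimes> y n \<ominus> h \<otimes> l = h \<otimes> (y n \<ominus> l)" for n
      by (simp add: minus_eq_smult r_distr smult_mult_right)
    then show "cnorm A (h \<otimes> y n \<ominus> h \<otimes> l) \<le> cnorm A h * cnorm A (y n \<ominus> l)" for n
      using cnorm_mult[of h "y n \<ominus> l"] by simp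
  qed auto
  ultimately have cl: "l \<otimes> h = h \<otimes> l" by (simp add: y(2)) (metis tends_unique)
  show ?thesis
  proof (rule that[of "\<one> \<ominus> l"])
    have "h \<otimes> h \<oplus> l \<otimes> l = 2 \<odot> F l" by (simp add: F_def)
    then have "h \<otimes> h \<oplus> l \<otimes> l = l \<oplus> l"
      unfolding Fl using smult_add_left[of l 1 1] by simp
    moreover have "s \<oplus> (\<one> \<ominus> l) \<otimes> (\<one> \<ominus> l) = \<one> \<oplus> ((s \<oplus> l \<otimes> l) \<ominus> (l \<oplus> l))"
      if "s \<in> carrier A" for s
      using that lc by (algebra, simp)
    moreover have "\<one> \<oplus> ((l \<oplus> l) \<ominus> (l \<oplus> l)) = \<one>"
      using lc by algebra
    ultimately show "h \<otimes> h \<oplus> (\<one> \<ominus> l) \<otimes> (\<one> \<ominus> l) = \<one>" by simp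
    show "(\<one> \<ominus> l) \<otimes> h = h \<otimes> (\<one> \<ominus> l)"
      by (simp add: minus_eq_smult l_distr r_distr smult_mult_left smult_mult_right cl)
  qed (auto simp: star_minus sl)
qed

end

section \<open>Homomorphisms\<close>

lemma star_homD:
  assumes "star_hom A B \<phi>" "x \<in> carrier A"
  shows "\<phi> x \<in> carrier B" "\<phi> (c \<odot>\<^bsub>A\<^esub> x) = c \<odot>\<^bsub>B\<^esub> \<phi> x" "\<phi> (star A x) = star B (\<phi> x)"
    "y \<in> carrier A \<Longrightarrow> \<phi> (x \<oplus>\<^bsub>A\<^esub> y) = \<phi> x \<oplus>\<^bsub>B\<^esub> \<phi> y"
    "y \<in> carrier A \<Longrightarrow> \<phi> (x \<otimes>\<^bsub>A\<^esub> y) = \<phi> x \<otimes>\<^bsub>B\<^esub> \<phi> y"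
  using assms by (auto simp: star_hom_def)

lemma star_hom_compose:
  assumes "star_hom A B \<phi>" "star_hom B D \<psi>"
  shows "star_hom A D (\<psi> \<circ> \<phi>)"
  using assms by (auto simp: star_hom_def Pi_iff)

lemma star_hom_zero:
  assumes "pre_cstar_algebra A" "pre_cstar_algebra B" "star_hom A B \<phi>"
  shows "\<phi> \<zero>\<^bsub>A\<^esub> = \<zero>\<^bsub>B\<^esub>"
proof -
  interpret A: pre_cstar_algebra A by fact
  interpret B: pre_cstar_algebra B by fact
  have "\<phi> \<zero>\<^bsub>A\<^esub> = \<phi> (0 \<odot>\<^bsub>A\<^esub> \<zero>\<^bsub>A\<^esub>)" by simp
  also have "\<dots> = 0 \<odot>\<^bsub>B\<^esub> \<phi> \<zero>\<^bsub>A\<^esub>" by (rule star_homD[OF assms(3)]) simp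
  also have "\<dots> = \<zero>\<^bsub>B\<^esub>" using star_homD(1)[OF assms(3)] by simp
  finally show ?thesis .
qed

lemma star_hom_finsum:
  assumes "pre_cstar_algebra A" "pre_cstar_algebra B" "star_hom A B \<phi>"
    and "finite I" "\<And>i. i \<in> I \<Longrightarrow> f i \<in> carrier A"
  shows "\<phi> (finsum A f I) = (\<Oplus>\<^bsub>B\<^esub>i\<in>I. \<phi> (f i))"
proof -
  interpret A: pre_cstar_algebra A by fact
  interpret B: pre_cstar_algebra B by fact
  show ?thesis
    using assms(4,5) by (induction I rule: finite_induct)
      (auto simp: Pi_def star_hom_zero[OF assms(1-3)] star_homD[OF assms(3)])
qed

text \<open>
  For self-adjoint \<open>h\<close> of norm less than \<open>1\<close> a commuting self-adjoint \<open>g\<close> with \<open>h\<^sup>2 + g\<^sup>2 = 1\<close>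
  exists. This relation is algebraic, so \<open>\<phi>\<close> carries it over to the projection \<open>\<phi> 1\<close> in place of
  the unit, and it forces \<open>\<phi> h\<close> to be a contraction. The general case follows from the C*-identity.
\<close>

lemma star_hom_contractive:
  assumes "cstar_algebra A" "pre_cstar_algebra B" and hom: "star_hom A B \<phi>" and x: "x \<in> carrier A"
  shows "cnorm B (\<phi> x) \<le> cnorm A x"
proof -
  interpret A: cstar_algebra A by fact
  interpret B: pre_cstar_algebra B by fact
  note hom = star_homD[OF hom]
  have sa: "cnorm B (\<phi> h) \<le> 1"
    if h: "h \<in> carrier A" "star A h = h" "cnorm A h < 1" for h
  proof -
    obtain g where g: "g \<in> carrier A" "star A g = g" "g \<otimes>\<^bsub>A\<^esub> h = h \<otimes>\<^bsub>A\<^esub> g"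
      "h \<otimes>\<^bsub>A\<^esub> h \<oplus>\<^bsub>A\<^esub> g \<otimes>\<^bsub>A\<^esub> g = \<one>\<^bsub>A\<^esub>"
      using A.sqrt_one_minus_square[OF h] .
    have "cnorm B (\<phi> \<one>\<^bsub>A\<^esub>) \<le> 1"
    proof (rule B.cnorm_projection_le_1)
      show "star B (\<phi> \<one>\<^bsub>A\<^esub>) \<otimes>\<^bsub>B\<^esub> \<phi> \<one>\<^bsub>A\<^esub> = \<phi> \<one>\<^bsub>A\<^esub>"
        by (simp flip: hom(3,5))
    qed (simp add: hom(1))
    also have "\<phi> \<one>\<^bsub>A\<^esub> = \<phi> h \<otimes>\<^bsub>B\<^esub> \<phi> h \<oplus>\<^bsub>B\<^esub> \<phi> g \<otimes>\<^bsub>B\<^esub> \<phi> g"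
      using g h by (simp flip: g(4) hom(4,5))
    finally show ?thesis
    proof (rule B.cnorm_commuting_selfadjoint_le[rotated -1])
      show "\<phi> g \<otimes>\<^bsub>B\<^esub> \<phi> h = \<phi> h \<otimes>\<^bsub>B\<^esub> \<phi> g" using g h by (simp flip: hom(5))
    qed (use g h in \<open>simp_all add: hom(1) flip: hom(3)\<close>)
  qed
  have lt: "cnorm B (\<phi> x) \<le> 1" if x: "x \<in> carrier A" "cnorm A x < 1" for x
  proof (rule B.cnorm_le_1I)
    have "cnorm A (star A x \<otimes>\<^bsub>A\<^esub> x) < 1"
      using x A.cnorm_nonneg[OF x(1)] by (simp add: A.cstar_identity power_less_one_iff abs_square_less_1)
    then have "cnorm B (\<phi> (star A x \<otimes>\<^bsub>A\<^esub> x)) \<le> 1"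
      using x by (intro sa) (auto simp: A.star_simps)
    then show "cnorm B (star B (\<phi> x) \<otimes>\<^bsub>B\<^esub> \<phi> x) \<le> 1"
      using x by (simp add: hom)
  qed (use x in \<open>simp add: hom\<close>)
  show ?thesis
  proof (rule dense_ge)
    fix r assume r: "cnorm A x < r"
    then have "0 < r" using A.cnorm_nonneg[OF x] by simp
    then have "cnorm B (\<phi> (complex_of_real (1 / r) \<odot>\<^bsub>A\<^esub> x)) \<le> 1"
      using r x by (intro lt) (auto simp: A.cnorm_smult norm_divide)
    with \<open>0 < r\<close> x show "cnorm B (\<phi> x) \<le> r"
      by (simp add: hom(1,2) B.cnorm_smult norm_divide)
  qed
qed


section \<open>Subalgebras\<close>

context pre_cstar_algebra
begin

lemma cstar_subalgebra_iff:
  "cstar_subalgebra A X \<longleftrightarrow> X \<subseteq> carrier A \<and> \<zero> \<in> X \<and>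
     (\<forall>x\<in>X. \<forall>y\<in>X. x \<oplus> y \<in> X) \<and> (\<forall>c. \<forall>x\<in>X. c \<odot> x \<in> X) \<and>
     (\<forall>x\<in>X. \<forall>y\<in>X. x \<otimes> y \<in> X) \<and> (\<forall>x\<in>X. star A x \<in> X) \<and>
     (\<forall>\<sigma> l. range \<sigma> \<subseteq> X \<and> tends \<sigma> l \<longrightarrow> l \<in> X)"
proof -
  have "submodule X complex_ring A \<longleftrightarrow> X \<subseteq> carrier A \<and> \<zero> \<in> X \<and>
     (\<forall>x\<in>X. \<forall>y\<in>X. x \<oplus> y \<in> X) \<and> (\<forall>c. \<forall>x\<in>X. c \<odot> x \<in> X)" (is "?l \<longleftrightarrow> ?r")
  proof
    assume l: ?l
    then have "\<zero> \<in> X"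
      using subgroup.one_closed[OF submodule.axioms(1)] by fastforce
    with scalar.submoduleE[OF l] show ?r by auto
  next
    assume r: ?r
    then have "\<ominus> x \<in> X" if "x \<in> X" for x
      using that minus_one_smult[of x] by (metis subsetD)
    with r show ?l by (intro scalar.submoduleI) auto
  qed
  then show ?thesis
    unfolding cstar_subalgebra_def using closedin_iff_tends by auto
qed

lemma cstar_subalgebra_carrier: "cstar_subalgebra A (carrier A)"
  by (auto simp: cstar_subalgebra_iff tends_def)

lemma cstar_subalgebraD:
  assumes "cstar_subalgebra A X"
  shows "X \<subseteq> carrier A" "\<And>x. x \<in> X \<Longrightarrow> x \<in> carrier A" "\<zero> \<in> X"
    "\<And>x y. x \<in> X \<Longrightarrow> y \<in> X \<Longrightarrow> x \<oplus> y \<in> X" "\<And>x c. x \<in> X \<Longrightarrow> c \<odot> x \<in> X"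
    "\<And>x y. x \<in> X \<Longrightarrow> y \<in> X \<Longrightarrow> x \<otimes> y \<in> X" "\<And>x. x \<in> X \<Longrightarrow> star A x \<in> X"
    "\<And>\<sigma> l. range \<sigma> \<subseteq> X \<Longrightarrow> tends \<sigma> l \<Longrightarrow> l \<in> X"
  using assms unfolding cstar_subalgebra_iff by auto

text \<open>
  The inclusion of \<open>X\<close> in the carrier matters: the hull is an intersection over the subalgebras that
  contain \<open>X\<close>, and there would otherwise be none.
\<close>

lemma cstar_subalgebra_hull:
  assumes "X \<subseteq> carrier A"
  shows "cstar_subalgebra A (cstar_subalgebra A hull X)" "cstar_subalgebra A hull X \<subseteq> carrier A"
proof -
  show le: "cstar_subalgebra A hull X \<subseteq> carrier A"
    using assms cstar_subalgebra_carrier by (rule hull_minimal)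
  have inI: "x \<in> cstar_subalgebra A hull X"
    if "\<And>Y. cstar_subalgebra A Y \<Longrightarrow> cstar_subalgebra A hull X \<subseteq> Y \<Longrightarrow> x \<in> Y" for x
  proof -
    have "x \<in> Y" if "cstar_subalgebra A Y" "X \<subseteq> Y" for Y
      using that \<open>\<And>Y. _ Y \<Longrightarrow> _ \<Longrightarrow> x \<in> Y\<close> by (simp add: hull_minimal)
    then show ?thesis by (simp add: hull_def)
  qed
  show "cstar_subalgebra A (cstar_subalgebra A hull X)"
  proof (rule iffD2[OF cstar_subalgebra_iff], intro conjI ballI allI impI)
    show "cstar_subalgebra A hull X \<subseteq> carrier A" by (rule le)
  qed (rule inI; meson cstar_subalgebraD subset_iff subset_trans)+
qed

lemma cstar_subalgebra_finsum:
  assumes "cstar_subalgebra A X" "finite I" "\<And>i. i \<in> I \<Longrightarrow> f i \<in> X"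
  shows "finsum A f I \<in> X"
  using assms(2,3,1)
  by (induction I rule: finite_induct) (auto simp: cstar_subalgebra_iff Pi_def subset_iff)

end

text \<open>
  Subalgebras need not contain the unit, while the algebra generated by a set keeps the unit of the
  ambient algebra as its unit. It is a C*-algebra in its own right once that unit belongs to it.
\<close>

context
  fixes A :: "'u cstar" and H
  assumes A: "cstar_algebra A" and H: "cstar_subalgebra A H" and one: "\<one>\<^bsub>A\<^esub> \<in> H"
begin

interpretation A: cstar_algebra A by (rule A)

lemmas subalgebra_closed = A.cstar_subalgebraD[OF H]

lemma subalgebra_pre_cstar: "pre_cstar_algebra (A\<lparr>carrier := H\<rparr>)"
proof -
  note cl = subalgebra_closed
  have mod: "Module.module complex_ring (A\<lparr>carrier := H\<rparr>)"
    using H submodule.submodule_is_module[OF _ A.scalar.module_axioms]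
    by (auto simp: cstar_subalgebra_def)
  have "Ring.ring (A\<lparr>carrier := H\<rparr>)"
  proof (rule ring.intro)
    show "abelian_group (A\<lparr>carrier := H\<rparr>)" using mod by (simp add: module_def)
    show "Group.monoid (A\<lparr>carrier := H\<rparr>)"
      by unfold_locales (auto simp: cl one A.m_assoc)
    show "ring_axioms (A\<lparr>carrier := H\<rparr>)"
      by unfold_locales (auto simp: cl A.l_distr A.r_distr)
  qed
  then interpret R: Ring.ring "A\<lparr>carrier := H\<rparr>" .
  interpret M: Module.module complex_ring "A\<lparr>carrier := H\<rparr>" by (rule mod)
  show ?thesis
    by unfold_locales
      (auto simp: cl A.smult_mult_left A.smult_mult_right A.star_simps A.cnorm_nonneg A.cnorm_eq_0
        A.cnorm_triangle A.cnorm_smult A.cnorm_mult A.cstar_identity)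
qed

interpretation H: pre_cstar_algebra "A\<lparr>carrier := H\<rparr>" by (rule subalgebra_pre_cstar)

lemma minus_subalgebra:
  "x \<in> H \<Longrightarrow> y \<in> H \<Longrightarrow> x \<ominus>\<^bsub>A\<lparr>carrier := H\<rparr>\<^esub> y = x \<ominus>\<^bsub>A\<^esub> y"
  using H.minus_eq_smult[of x y] A.minus_eq_smult[of x y] subalgebra_closed(2) by simp

lemma tends_subalgebra_iff:
  "pre_cstar_algebra.tends (A\<lparr>carrier := H\<rparr>) \<sigma> l \<longleftrightarrow> range \<sigma> \<subseteq> H \<and> A.tends \<sigma> l"
proof -
  have "H.tends \<sigma> l \<longleftrightarrow> range \<sigma> \<subseteq> H \<and> l \<in> H \<and> (\<lambda>n. cnorm A (\<sigma> n \<ominus>\<^bsub>A\<^esub> l)) \<longlonglongrightarrow> 0"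
    by (auto simp: H.tends_def minus_subalgebra image_subset_iff cong: conj_cong)
  also have "\<dots> \<longleftrightarrow> range \<sigma> \<subseteq> H \<and> A.tends \<sigma> l"
    using subalgebra_closed(1,8) unfolding A.tends_def by blast
  finally show ?thesis .
qed

lemma subalgebra_cstar_algebra: "cstar_algebra (A\<lparr>carrier := H\<rparr>)"
proof (intro cstar_algebra.intro subalgebra_pre_cstar cstar_algebra_axioms.intro)
  have "\<exists>l. H.tends \<sigma> l"
    if \<sigma>: "range \<sigma> \<subseteq> H" and c: "\<forall>\<epsilon>>0. \<exists>N. \<forall>n\<ge>N. \<forall>n'\<ge>N. cnorm A (\<sigma> n \<ominus>\<^bsub>A\<lparr>carrier := H\<rparr>\<^esub> \<sigma> n') < \<epsilon>" for \<sigma>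
  proof -
    have "\<sigma> n \<in> H" for n using \<sigma> by auto
    with c have "\<forall>\<epsilon>>0. \<exists>N. \<forall>n\<ge>N. \<forall>n'\<ge>N. cnorm A (\<sigma> n \<ominus>\<^bsub>A\<^esub> \<sigma> n') < \<epsilon>" by (simp add: minus_subalgebra)
    then obtain l where "A.tends \<sigma> l"
      using A.complete \<sigma> subalgebra_closed(1) unfolding A.mcomplete_iff_tends by blast
    with \<sigma> show ?thesis by (auto simp: tends_subalgebra_iff)
  qed
  then show "Metric_space.mcomplete (carrier (A\<lparr>carrier := H\<rparr>)) (cdist (A\<lparr>carrier := H\<rparr>))"
    unfolding H.mcomplete_iff_tends by simp
qed

lemma cstar_subalgebra_trans:
  "cstar_subalgebra (A\<lparr>carrier := H\<rparr>) X \<longleftrightarrow> cstar_subalgebra A X \<and> X \<subseteq> H"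
proof -
  have "(\<forall>\<sigma> l. range \<sigma> \<subseteq> X \<and> H.tends \<sigma> l \<longrightarrow> l \<in> X) \<longleftrightarrow>
      (\<forall>\<sigma> l. range \<sigma> \<subseteq> X \<and> A.tends \<sigma> l \<longrightarrow> l \<in> X)" if "X \<subseteq> H"
    using that unfolding tends_subalgebra_iff by blast
  then show ?thesis
    using subalgebra_closed(1) unfolding A.cstar_subalgebra_iff H.cstar_subalgebra_iff by auto
qed

lemma finsum_subalgebra:
  assumes "finite I" "\<And>i. i \<in> I \<Longrightarrow> f i \<in> H"
  shows "finsum (A\<lparr>carrier := H\<rparr>) f I = finsum A f I"
  using assms by (induction I rule: finite_induct) (auto simp: Pi_def subalgebra_closed(2))

end

section \<open>Cuntz isometries and the relations of the local family\<close>

text \<open>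
  The axioms of a local quantum Cuntz--Krieger family of the dephasing graph, expressed in the rescaled
  images \<open>t i j\<close> of the adapted matrix units. The rescaling absorbs all powers of \<open>n\<close>.
\<close>

definition local_relations :: "'u cstar \<Rightarrow> ('n::finite \<Rightarrow> 'n \<Rightarrow> 'u) \<Rightarrow> bool" where
  "local_relations A t \<longleftrightarrow> (\<forall>i j. t i j \<in> carrier A) \<and>
     (\<forall>i j k l. (\<Oplus>\<^bsub>A\<^esub>r\<in>UNIV. t i r \<otimes>\<^bsub>A\<^esub> star A (t j r)) \<otimes>\<^bsub>A\<^esub> t k l = (if j = k then t i l else \<zero>\<^bsub>A\<^esub>)) \<and>
     (\<forall>i j k l. star A (t j i) \<otimes>\<^bsub>A\<^esub> t k l =
        (if j = k \<and> i = l then \<Oplus>\<^bsub>A\<^esub>r\<in>UNIV. t i r \<otimes>\<^bsub>A\<^esub> star A (t i r) else \<zero>\<^bsub>A\<^esub>)) \<and>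
     (\<Oplus>\<^bsub>A\<^esub>i\<in>UNIV. \<Oplus>\<^bsub>A\<^esub>r\<in>UNIV. t i r \<otimes>\<^bsub>A\<^esub> star A (t i r)) = \<one>\<^bsub>A\<^esub>"

context pre_cstar_algebra
begin

lemma finsum_mult_left:
  assumes "finite I" "x \<in> carrier A" "\<And>i. i \<in> I \<Longrightarrow> f i \<in> carrier A"
  shows "x \<otimes> finsum A f I = (\<Oplus>i\<in>I. x \<otimes> f i)"
  using assms by (simp add: finsum_rdistr Pi_def)

lemma finsum_mult_right:
  assumes "finite I" "x \<in> carrier A" "\<And>i. i \<in> I \<Longrightarrow> f i \<in> carrier A"
  shows "finsum A f I \<otimes> x = (\<Oplus>i\<in>I. f i \<otimes> x)"
  using assms by (simp add: finsum_ldistr Pi_def)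

lemma finsum_eqI:
  assumes "\<And>i. i \<in> I \<Longrightarrow> g i \<in> carrier A" "\<And>i. i \<in> I \<Longrightarrow> f i = g i"
  shows "finsum A f I = finsum A g I"
  using assms by (intro finsum_cong') auto

lemma finsum_delta:
  assumes "finite I" "i \<in> I" "f i \<in> carrier A"
  shows "(\<Oplus>j\<in>I. if j = i then f j else \<zero>) = f i"
proof -
  have "(\<Oplus>j\<in>I. if j = i then f j else \<zero>) = (\<Oplus>j\<in>I. if i = j then f i else \<zero>)"
    using assms by (intro finsum_eqI) auto
  also have "\<dots> = f i" using assms by (intro finsum_singleton[of i I "\<lambda>_. f i"]) auto
  finally show ?thesis .
qed

lemma finsum_zeroI: "(\<And>i. i \<in> I \<Longrightarrow> f i = \<zero>) \<Longrightarrow> finsum A f I = \<zero>"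
  by (rule add.finprod_one_eqI) auto

text \<open>
  A partial isometry absorbs its initial projection: expanding \<open>(x p - x)\<^sup>* (x p - x)\<close> with
  \<open>x\<^sup>* x = p\<close> gives \<open>0\<close>.
\<close>

lemma projection_domain:
  assumes "x \<in> carrier A" "p \<in> carrier A" "star A x \<otimes> x = p" "star A p = p" "p \<otimes> p = p"
  shows "x \<otimes> p = x"
proof -
  have "star A (x \<otimes> p \<ominus> x) \<otimes> (x \<otimes> p \<ominus> x) =
      (p \<otimes> star A x \<ominus> star A x) \<otimes> (x \<otimes> p \<ominus> x)"
    using assms by (simp add: star_minus star_mult)
  also have "\<dots> = p \<otimes> (star A x \<otimes> x) \<otimes> p \<ominus> p \<otimes> (star A x \<otimes> x) \<ominus> (star A x \<otimes> x) \<otimes> p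
      \<oplus> star A x \<otimes> x"
  proof -
    have "star A x \<in> carrier A" using assms by simp
    then show ?thesis using assms(1,2) by algebra
  qed
  also have "\<dots> = p \<ominus> p \<ominus> p \<oplus> p" using assms by simp
  also have "\<dots> = \<zero>" using assms(2) by algebra
  finally have "x \<otimes> p \<ominus> x = \<zero>" using assms by - (rule eq_zero_if_star_mult_self, simp_all)
  then show ?thesis using assms by (simp add: minus_eq_zero_iff)
qed

text \<open>
  The sums \<open>P i i\<close> of all \<open>t i r \<otimes> star A (t i r)\<close> are mutually orthogonal projections with sum \<open>1\<close>, and \<open>t i j\<close> is a partial
  isometry with initial projection \<open>P j j\<close>. Hence in \<open>V i \<otimes> star A (V i)\<close> the mixed products of
  \<open>t i j\<close> and \<open>star A (t i l)\<close> vanish, leaving \<open>P i i\<close>; and \<open>t i j\<close> is recovered from \<open>V i\<close>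
  by cutting down with \<open>P j j\<close>, which is itself \<open>V j \<otimes> star A (V j)\<close>.
\<close>

lemma local_relations_imp_cuntz:
  fixes t :: "'n::finite \<Rightarrow> 'n \<Rightarrow> 'u"
  assumes "local_relations A t"
  defines "V \<equiv> \<lambda>i. \<Oplus>j\<in>UNIV. t i j"
  shows "cuntz_isometries A V" and "t i j = V i \<otimes> (V j \<otimes> star A (V j))"
proof -
  define P where "P i j = (\<Oplus>r\<in>UNIV. t i r \<otimes> star A (t j r))" for i j
  have t [simp]: "t i j \<in> carrier A" for i j using assms by (simp add: local_relations_def)
  have P [simp]: "P i j \<in> carrier A" for i j by (simp add: P_def)
  have Pt: "P i j \<otimes> t k l = (if j = k then t i l else \<zero>)" for i j k l
    using assms by (simp add: local_relations_def P_def)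
  have tt: "star A (t j i) \<otimes> t k l = (if j = k \<and> i = l then P i i else \<zero>)" for i j k l
    using assms by (auto simp: local_relations_def P_def)
  have sum1: "(\<Oplus>i\<in>UNIV. P i i) = \<one>"
    using assms by (simp add: local_relations_def P_def)
  have V [simp]: "V i \<in> carrier A" for i by (simp add: V_def)
  have sP: "star A (P i i) = P i i" for i
    by (simp add: P_def star_finsum star_mult star_star)
  have PP: "P i i \<otimes> P k k = (if i = k then P i i else \<zero>)" for i k
  proof -
    have "P i i \<otimes> P k k = (\<Oplus>r\<in>UNIV. (P i i \<otimes> t k r) \<otimes> star A (t k r))"
      unfolding P_def[of k k] by (simp add: finsum_mult_left m_assoc)
    then show ?thesis by (simp add: Pt finsum_zeroI flip: P_def)
  qed
  \<comment> \<open>Mixed products vanish since the initial projections are orthogonal.\<close>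
  have tP: "t i j \<otimes> P k k = (if j = k then t i j else \<zero>)" for i j k
  proof -
    have *: "t i j \<otimes> P j j = t i j"
      by (rule projection_domain) (simp_all add: tt sP PP)
    have "t i j \<otimes> P k k = t i j \<otimes> (P j j \<otimes> P k k)"
      using * by (metis m_assoc t P)
    then show ?thesis using * by (auto simp: PP)
  qed
  have tts: "t i j \<otimes> star A (t k l) = \<zero>" if "j \<noteq> l" for i j k l
  proof -
    have "star A (t k l) = P l l \<otimes> star A (t k l)"
      using arg_cong[OF tP[of k l l], of "star A"] by (simp add: star_mult sP)
    then have "t i j \<otimes> star A (t k l) = (t i j \<otimes> P l l) \<otimes> star A (t k l)"
      by (metis m_assoc t P star_closed)
    then show ?thesis using that by (simp add: tP)
  qed
  have VV: "V i \<otimes> star A (V i) = P i i" for i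
  proof -
    have "V i \<otimes> star A (V i) = (\<Oplus>l\<in>UNIV. \<Oplus>j\<in>UNIV. t i j \<otimes> star A (t i l))"
      by (simp add: V_def star_finsum finsum_mult_left finsum_mult_right)
    also have "\<dots> = (\<Oplus>l\<in>UNIV. \<Oplus>j\<in>UNIV. if j = l then t i j \<otimes> star A (t i j) else \<zero>)"
      by (intro finsum_eqI) (auto simp: tts)
    also have "\<dots> = P i i" unfolding P_def
      by (intro finsum_eqI) (auto intro!: finsum_delta)
    finally show ?thesis .
  qed
  have "star A (V i) \<otimes> V i = \<one>" for i
  proof -
    have "star A (V i) \<otimes> V i = (\<Oplus>j\<in>UNIV. \<Oplus>l\<in>UNIV. star A (t i l) \<otimes> t i j)"
      by (simp add: V_def star_finsum finsum_mult_left finsum_mult_right)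
    also have "\<dots> = (\<Oplus>j\<in>UNIV. \<Oplus>l\<in>UNIV. if l = j then P l l else \<zero>)"
      by (intro finsum_eqI) (auto simp: tt)
    also have "\<dots> = (\<Oplus>j\<in>UNIV. P j j)"
      by (intro finsum_eqI) (auto intro!: finsum_delta)
    finally show ?thesis by (simp add: sum1)
  qed
  then show "cuntz_isometries A V" by (simp add: cuntz_isometries_def VV sum1)
  have "V i \<otimes> P j j = (\<Oplus>l\<in>UNIV. if l = j then t i l else \<zero>)"
    unfolding V_def by (simp add: finsum_mult_right tP cong: if_cong)
  also have "\<dots> = t i j" by (rule finsum_delta) auto
  finally show "t i j = V i \<otimes> (V j \<otimes> star A (V j))" by (simp add: VV)
qed

text \<open>
  The extreme point property in the form that applies to a sum of several contractions, whose norm is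
  bounded by their number.
\<close>

lemma zero_if_balanced:
  assumes z: "z \<in> carrier A" "star A z = z" and c: "0 < c"
    and pm: "cnorm A (complex_of_real c \<odot> \<one> \<oplus> z) \<le> c" "cnorm A (complex_of_real c \<odot> \<one> \<ominus> z) \<le> c"
  shows "z = \<zero>"
proof -
  define w where "w = complex_of_real (1/c) \<odot> z"
  have w [simp]: "w \<in> carrier A" by (simp add: w_def z)
  have e: "\<one> \<oplus> w = complex_of_real (1/c) \<odot> (complex_of_real c \<odot> \<one> \<oplus> z)"
    "\<one> \<ominus> w = complex_of_real (1/c) \<odot> (complex_of_real c \<odot> \<one> \<ominus> z)"
    using c z by (simp_all add: w_def smult_add_right minus_eq_smult)
  have "w = \<zero>"
  proof (rule one_extreme_selfadjoint)
    show "star A w = w" using z by (simp add: w_def star_smult)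
    show "cnorm A (\<one> \<oplus> w) \<le> 1" "cnorm A (\<one> \<ominus> w) \<le> 1"
      unfolding e using pm c z by (simp_all add: cnorm_smult norm_divide field_simps)
  qed simp
  then have "complex_of_real c \<odot> w = \<zero>" by simp
  with c z show ?thesis by (simp add: w_def)
qed

text \<open>
  Orthogonality of the ranges is a statement about positivity: the elements \<open>y k\<close>, the projections
  \<open>p k\<close> compressed by \<open>v j\<close>, are positive with sum \<open>1\<close>, and \<open>y j = 1\<close>, so the others must vanish.
  Instead of positivity the proof uses that each \<open>1 - y k\<close> is a contraction, being the compression of
  the projection \<open>1 - p k\<close>. For \<open>i \<noteq> j\<close>, with \<open>R\<close> the set of remaining indices,
  \<open>y i = - (\<Sum>k\<in>R. y k)\<close>, so \<open>card R + y i = (\<Sum>k\<in>R. 1 - y k)\<close> has norm at most \<open>card R\<close>. Together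
  with \<open>\<parallel>1 - y i\<parallel> \<le> 1\<close> this bounds \<open>N + y i\<close> and \<open>N - y i\<close> by \<open>N = card R + 1\<close>, hence \<open>y i = 0\<close>.
\<close>

lemma cuntz_isometries_orthogonal:
  fixes v :: "'n::finite \<Rightarrow> 'u"
  assumes "cuntz_isometries A v"
  shows "star A (v i) \<otimes> v j = (if i = j then \<one> else \<zero>)"
proof (cases "i = j")
  case False
  have v [simp]: "v k \<in> carrier A" for k using assms by (simp add: cuntz_isometries_def)
  have iso: "star A (v k) \<otimes> v k = \<one>" for k using assms by (simp add: cuntz_isometries_def)
  have sum1: "(\<Oplus>k\<in>UNIV. v k \<otimes> star A (v k)) = \<one>" using assms by (simp add: cuntz_isometries_def)
  define p where "p k = v k \<otimes> star A (v k)" for k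
  have p [simp]: "p k \<in> carrier A" for k by (simp add: p_def)
  have sp: "star A (p k) = p k" for k by (simp add: p_def star_mult star_star)
  have pp: "p k \<otimes> p k = p k" for k
  proof -
    have "p k \<otimes> p k = v k \<otimes> (star A (v k) \<otimes> v k) \<otimes> star A (v k)"
      by (simp add: p_def m_assoc)
    then show ?thesis by (simp add: iso p_def)
  qed
  have vle: "cnorm A (v k) \<le> 1" for k
    by (rule cnorm_le_1I) (simp_all add: iso cnorm_one_le_1)
  define y where "y k = star A (v j) \<otimes> p k \<otimes> v j" for k
  have y [simp]: "y k \<in> carrier A" for k by (simp add: y_def)
  have sy: "star A (y k) = y k" for k by (simp add: y_def star_mult star_star sp m_assoc)
  have y_le: "cnorm A (\<one> \<ominus> y k) \<le> 1" for k
  proof -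
    have "\<one> \<ominus> y k = star A (v j) \<otimes> (\<one> \<ominus> p k) \<otimes> v j"
      by (simp add: minus_eq_smult y_def iso l_distr r_distr smult_mult_left smult_mult_right)
    moreover have "cnorm A (\<one> \<ominus> p k) \<le> 1"
    proof (rule cnorm_projection_le_1)
      have "star A (\<one> \<ominus> p k) \<otimes> (\<one> \<ominus> p k) = \<one> \<ominus> p k \<ominus> p k \<oplus> p k \<otimes> p k"
      proof -
        have "star A (\<one> \<ominus> p k) = \<one> \<ominus> p k" by (simp add: star_minus sp)
        moreover have "(\<one> \<ominus> x) \<otimes> (\<one> \<ominus> x) = \<one> \<ominus> x \<ominus> x \<oplus> x \<otimes> x" if "x \<in> carrier A" for x
          using that by (algebra, simp)
        ultimately show ?thesis by simp
      qed
      also have "\<dots> = \<one> \<ominus> p k"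
      proof -
        have "\<one> \<ominus> x \<ominus> x \<oplus> x = \<one> \<ominus> x" if "x \<in> carrier A" for x using that by algebra
        then show ?thesis by (simp add: pp)
      qed
      finally show "star A (\<one> \<ominus> p k) \<otimes> (\<one> \<ominus> p k) = \<one> \<ominus> p k" .
    qed simp
    ultimately show ?thesis using vle by (simp add: cnorm_mult_le_1)
  qed
  have "(\<Oplus>k\<in>UNIV. y k) = star A (v j) \<otimes> (\<Oplus>k\<in>UNIV. p k) \<otimes> v j"
    by (simp add: y_def finsum_mult_left finsum_mult_right)
  also have "\<dots> = \<one>" using sum1 by (simp add: p_def iso)
  finally have total: "(\<Oplus>k\<in>UNIV. y k) = \<one>" .
  have "insert j (insert i (UNIV - {i, j})) = UNIV" by auto
  with total have "(\<Oplus>k\<in>insert j (insert i (UNIV - {i, j})). y k) = \<one>" by (simp only:)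
  moreover have "y j = \<one>"
    using iso by (simp add: y_def p_def m_assoc)
  ultimately have "\<one> \<oplus> (y i \<oplus> (\<Oplus>k\<in>UNIV - {i, j}. y k)) = \<one>"
    using False by (simp add: Pi_def)
  then have rest: "y i \<oplus> (\<Oplus>k\<in>UNIV - {i, j}. y k) = \<zero>" by simp
  \<comment> \<open>The indices other than \<open>i\<close> and \<open>j\<close>; this set may be empty, and the summand \<open>1\<close> keeps \<open>N\<close> positive.\<close>
  define R where "R = UNIV - {i, j}"
  define N where "N = real (card R) + 1"
  have "cnorm A (complex_of_real N \<odot> \<one> \<oplus> y i) \<le> N"
  proof -
    have "finsum A (\<lambda>k. \<one> \<ominus> y k) R \<oplus> finsum A y R = of_nat (card R) \<odot> \<one>"
    proof -
      have "finite R" by (simp add: R_def)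
      then show ?thesis
      proof (induction R rule: finite_induct)
        case (insert k R)
        have "((\<one> \<ominus> a) \<oplus> b) \<oplus> (a \<oplus> c) = \<one> \<oplus> (b \<oplus> c)"
          if "a \<in> carrier A" "b \<in> carrier A" "c \<in> carrier A" for a b c
          using that by algebra
        with insert show ?case by (simp add: Pi_def smult_add_left)
      qed simp
    qed
    moreover have "(a \<oplus> c) \<oplus> d = a"
      if "d \<oplus> c = \<zero>" "a \<in> carrier A" "c \<in> carrier A" "d \<in> carrier A" for a c d
      using that by (simp add: a_assoc a_comm[of c d])
    from this[of "y i" "finsum A y R" "finsum A (\<lambda>k. \<one> \<ominus> y k) R"] rest
    have "(finsum A (\<lambda>k. \<one> \<ominus> y k) R \<oplus> finsum A y R) \<oplus> y i = finsum A (\<lambda>k. \<one> \<ominus> y k) R"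
      by (simp add: R_def)
    ultimately have "finsum A (\<lambda>k. \<one> \<ominus> y k) R = of_nat (card R) \<odot> \<one> \<oplus> y i" by simp
    then have "complex_of_real N \<odot> \<one> \<oplus> y i = \<one> \<oplus> finsum A (\<lambda>k. \<one> \<ominus> y k) R"
      by (simp add: N_def smult_add_left a_ac)
    also have "cnorm A \<dots> \<le> 1 + (\<Sum>k\<in>R. cnorm A (\<one> \<ominus> y k))"
      by (intro order.trans[OF cnorm_triangle] add_mono cnorm_one_le_1 cnorm_finsum_le)
        (auto simp: R_def)
    also have "\<dots> \<le> 1 + (\<Sum>k\<in>R. 1)" by (intro add_mono sum_mono y_le) simp
    finally show ?thesis by (simp add: N_def)
  qed
  moreover have "cnorm A (complex_of_real N \<odot> \<one> \<ominus> y i) \<le> N"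
  proof -
    have "complex_of_real N \<odot> \<one> \<ominus> y i = of_nat (card R) \<odot> \<one> \<oplus> (\<one> \<ominus> y i)"
      by (simp add: N_def smult_add_left minus_eq_smult a_ac)
    then show ?thesis
      using cnorm_triangle[of "of_nat (card R) \<odot> \<one>" "\<one> \<ominus> y i"] y_le[of i] cnorm_one_le_1
        mult_left_mono[OF cnorm_one_le_1, of "real (card R)"]
      by (simp add: cnorm_smult N_def)
  qed
  ultimately have "y i = \<zero>"
    using sy by (intro zero_if_balanced[of _ N]) (auto simp: N_def)
  moreover have "y i = star A (star A (v i) \<otimes> v j) \<otimes> (star A (v i) \<otimes> v j)"
    by (simp add: y_def p_def star_mult star_star m_assoc)
  ultimately have "star A (v i) \<otimes> v j = \<zero>"
    by - (rule eq_zero_if_star_mult_self, simp_all)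
  with False show ?thesis by simp
qed (use assms in \<open>simp add: cuntz_isometries_def\<close>)

text \<open>
  Since \<open>t i j\<close> is \<open>v i\<close> restricted to the range of \<open>v j\<close>, the sums in the relations collapse to
  \<open>v i \<otimes> star A (v j)\<close> by completeness of the ranges, and everything else is orthogonality.
\<close>

lemma cuntz_imp_local_relations:
  fixes v :: "'n::finite \<Rightarrow> 'u"
  assumes "cuntz_isometries A v"
  defines "t \<equiv> \<lambda>i j. v i \<otimes> (v j \<otimes> star A (v j))"
  shows "local_relations A t" and "v i = (\<Oplus>j\<in>UNIV. t i j)"
proof -
  have v [simp]: "v k \<in> carrier A" for k using assms by (simp add: cuntz_isometries_def)
  have sum1: "(\<Oplus>k\<in>UNIV. v k \<otimes> star A (v k)) = \<one>" using assms by (simp add: cuntz_isometries_def)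
  note orth = cuntz_isometries_orthogonal[OF assms(1)]
  have orth': "star A (v i) \<otimes> (v j \<otimes> x) = (if i = j then x else \<zero>)" if "x \<in> carrier A" for i j x
    using orth[of i j] that by (simp flip: m_assoc)
  have t [simp]: "t i j \<in> carrier A" for i j by (simp add: t_def)
  have P: "(\<Oplus>r\<in>UNIV. t i r \<otimes> star A (t j r)) = v i \<otimes> star A (v j)" for i j
  proof -
    have "t i r \<otimes> star A (t j r) = v i \<otimes> ((v r \<otimes> star A (v r)) \<otimes> star A (v j))" for r
      by (simp add: t_def star_mult star_star m_assoc orth')
    then have "(\<Oplus>r\<in>UNIV. t i r \<otimes> star A (t j r)) =
        v i \<otimes> ((\<Oplus>r\<in>UNIV. v r \<otimes> star A (v r)) \<otimes> star A (v j))"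
      by (simp add: finsum_mult_left finsum_mult_right)
    then show ?thesis by (simp add: sum1)
  qed
  have "v i \<otimes> star A (v j) \<otimes> t k l = (if j = k then t i l else \<zero>)" for i j k l
    by (simp add: t_def m_assoc orth')
  moreover have "star A (t j i) \<otimes> t k l = (if j = k \<and> i = l then v i \<otimes> star A (v i) else \<zero>)" for i j k l
    by (simp add: t_def star_mult star_star m_assoc orth')
  ultimately show "local_relations A t"
    by (simp add: local_relations_def P sum1)
  have "(\<Oplus>j\<in>UNIV. t i j) = v i \<otimes> (\<Oplus>j\<in>UNIV. v j \<otimes> star A (v j))"
    by (simp add: t_def finsum_mult_left)
  then show "v i = (\<Oplus>j\<in>UNIV. t i j)" by (simp add: sum1)
qed

end


section \<open>Local quantum Cuntz--Krieger families as relations between matrix entries\<close>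

lemma cscale_nth [simp]: "cscale c X $ i $ j = c * X $ i $ j"
  by (simp add: map_matrix_def)

definition cmat_linear :: "('a::finite cmat \<Rightarrow> 'b::finite cmat) \<Rightarrow> bool" where
  "cmat_linear L \<longleftrightarrow> (\<forall>X Y. L (X + Y) = L X + L Y) \<and> (\<forall>c X. L (cscale c X) = cscale c (L X))"

lemma cmat_linear_mat_mult: "cmat_linear mat_mult"
  by (simp add: cmat_linear_def vec_eq_iff mat_mult_nth sum.distrib sum_distrib_left)

lemma cmat_linear_mat_comult: "cmat_linear mat_comult"
  by (simp add: cmat_linear_def vec_eq_iff mat_comult_eq algebra_simps)

lemma cmat_linear_dephasing: "cmat_linear dephasing"
  by (simp add: cmat_linear_def vec_eq_iff dephasing_def algebra_simps)

lemma cmat_linear_tensor_map: "cmat_linear (tensor_map F G)"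
  by (simp add: cmat_linear_def vec_eq_iff tensor_map_def sum.distrib sum_distrib_left algebra_simps)

lemma cmat_linear_tensor_left: "cmat_linear (\<lambda>X. tensor X Y)"
  by (simp add: cmat_linear_def vec_eq_iff tensor_def algebra_simps)

lemma cmat_linear_tensor_right: "cmat_linear (\<lambda>Y. tensor X Y)"
  by (simp add: cmat_linear_def vec_eq_iff tensor_def algebra_simps)

lemma cmat_linear_compose: "cmat_linear L \<Longrightarrow> cmat_linear L' \<Longrightarrow> cmat_linear (\<lambda>X. L (L' X))"
  by (simp add: cmat_linear_def)

lemma cmat_decomp: "X = (\<Sum>p\<in>UNIV. \<Sum>q\<in>UNIV. cscale (X $ p $ q) (munit p q))"
proof -
  have "(\<Sum>p\<in>UNIV. \<Sum>q\<in>UNIV. cscale (X $ p $ q) (munit p q)) $ i $ j = X $ i $ j" for i j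
  proof -
    have "(\<Sum>p\<in>UNIV. \<Sum>q\<in>UNIV. cscale (X $ p $ q) (munit p q)) $ i $ j =
        (\<Sum>p\<in>UNIV. \<Sum>q\<in>UNIV. if q = j then if p = i then X $ p $ q else 0 else 0)"
      unfolding sum_component by (intro sum.cong) (auto simp: munit_nth)
    then show ?thesis by simp
  qed
  then show ?thesis by (simp add: vec_eq_iff)
qed

lemma munit_pair: "munit p q = tensor (munit (fst p) (fst q)) (munit (snd p) (snd q))"
  by (auto simp: vec_eq_iff tensor_def munit_nth prod_eq_iff)

lemma tensor_map_munit:
  "tensor_map F G (munit p q) = tensor (F (munit (fst p) (fst q))) (G (munit (snd p) (snd q)))"
proof -
  have "tensor_map F G (munit p q) = (\<Sum>a\<in>UNIV. \<Sum>b\<in>UNIV. if b = q then if a = p then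
      tensor (F (munit (fst p) (fst q))) (G (munit (snd p) (snd q))) else 0 else 0)"
    unfolding tensor_map_def by (intro sum.cong) (auto simp: munit_nth vec_eq_iff)
  then show ?thesis by simp
qed

lemma mat_mult_munit:
  "mat_mult (munit p q) = (if fst q = snd p then munit (fst p) (snd q) else 0)"
  by (simp add: munit_pair mat_mult_tensor munit_mult)

lemma mat_comult_munit:
  "mat_comult (munit i j :: 'n::finite cmat) =
     cscale (of_nat CARD('n)) (\<Sum>k\<in>UNIV. tensor (munit i k) (munit k j))"
proof -
  have "(\<Sum>k\<in>UNIV. tensor (munit i k) (munit k j)) $ p $ q =
      (\<Sum>k\<in>UNIV. if k = fst q then if i = fst p \<and> snd p = fst q \<and> j = snd q then 1 else 0 else (0::complex))"
    for p q :: "'n \<times> 'n"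
    unfolding sum_component by (intro sum.cong) (auto simp: tensor_def munit_nth)
  then show ?thesis by (auto simp: vec_eq_iff mat_comult_eq munit_nth)
qed

lemma dephasing_munit:
  "dephasing (munit i j :: 'n::finite cmat) =
     (if i = j then cscale (of_nat CARD('n)) (munit i i) else 0)"
  by (auto simp: vec_eq_iff dephasing_def munit_nth)

lemma mat_1_eq: "mat 1 = (\<Sum>i\<in>UNIV. munit i i :: 'n::finite cmat)"
proof -
  have "(\<Sum>k\<in>UNIV. munit k k :: 'n cmat) $ i $ j = (\<Sum>k\<in>UNIV. if k = i then if i = j then 1 else 0 else 0)"
    for i j :: 'n
    unfolding sum_component by (intro sum.cong) (auto simp: munit_nth)
  then show ?thesis by (simp add: vec_eq_iff mat_def)
qed

lemma cadj_munit: "cadj (munit i j) = munit j i"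
  by (auto simp: vec_eq_iff cadj_def transpose_def munit_nth map_matrix_def)

context pre_cstar_algebra
begin

lemma linear_intoD:
  assumes "linear_into A F"
  shows "F X \<in> carrier A" "F (X + Y) = F X \<oplus> F Y" "F (cscale c X) = c \<odot> F X"
  using assms by (auto simp: linear_into_def)

lemma linear_into_zero:
  fixes F :: "'n::finite cmat \<Rightarrow> 'u"
  assumes F: "linear_into A F"
  shows "F 0 = \<zero>"
proof -
  have "F (cscale 0 0) = \<zero>" using linear_intoD[OF F] by simp
  moreover have "cscale 0 0 = (0 :: 'n::finite cmat)" by (simp add: vec_eq_iff)
  ultimately show ?thesis by simp
qed

lemma linear_into_sum:
  assumes "linear_into A F" "finite I"
  shows "F (sum f I) = (\<Oplus>i\<in>I. F (f i))"
  using assms(2) by (induction I rule: finite_induct)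
    (auto simp: linear_into_zero[OF assms(1)] linear_intoD[OF assms(1)] Pi_def)

lemma linear_into_expand:
  assumes "linear_into A F"
  shows "F X = (\<Oplus>p\<in>UNIV. \<Oplus>q\<in>UNIV. X $ p $ q \<odot> F (munit p q))"
  by (subst cmat_decomp[of X]) (simp add: linear_into_sum[OF assms] linear_intoD[OF assms])

text \<open>
  Both sides of the axioms of a family are linear in the tensor, so they may be tested on matrix units.
\<close>

lemma linear_into_eq_iff:
  assumes "linear_into A F" "linear_into A G"
  shows "(\<forall>X. F X = G X) \<longleftrightarrow> (\<forall>p q. F (munit p q) = G (munit p q))"
proof (intro iffI allI)
  fix X
  assume "\<forall>p q. F (munit p q) = G (munit p q)"
  then show "F X = G X"
    by (subst (1 2) linear_into_expand) (simp_all add: assms)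
qed simp

lemma linear_into_compose: "linear_into A F \<Longrightarrow> cmat_linear L \<Longrightarrow> linear_into A (\<lambda>X. F (L X))"
  by (simp add: linear_into_def cmat_linear_def)

lemma linear_into_smult: "linear_into A F \<Longrightarrow> linear_into A (\<lambda>X. c \<odot> F X)"
  by (simp add: linear_into_def smult_add_right mult.commute)

lemma linear_into_mult_right: "linear_into A F \<Longrightarrow> y \<in> carrier A \<Longrightarrow> linear_into A (\<lambda>X. F X \<otimes> y)"
  by (simp add: linear_into_def l_distr smult_mult_left)

lemma linear_into_mult_left: "linear_into A F \<Longrightarrow> y \<in> carrier A \<Longrightarrow> linear_into A (\<lambda>X. y \<otimes> F X)"
  by (simp add: linear_into_def r_distr smult_mult_right)

lemma linear_into_star_map:
  fixes F :: "'b::finite cmat \<Rightarrow> 'u"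
  assumes "linear_into A F"
  shows "linear_into A (star_map A F)"
proof -
  have "cadj (X + Y) = cadj X + cadj Y" "cadj (cscale c X) = cscale (cnj c) (cadj X)"
    for X Y :: "'b cmat" and c
    by (simp_all add: vec_eq_iff cadj_def transpose_def map_matrix_def)
  with assms show ?thesis by (simp add: linear_into_def star_map_def star_simps)
qed

lemma linear_into_coefficients:
  assumes "\<And>p q. f p q \<in> carrier A"
  shows "linear_into A (\<lambda>X. \<Oplus>p\<in>UNIV. \<Oplus>q\<in>UNIV. X $ p $ q \<odot> f p q)"
  using assms by (simp add: linear_into_def smult_add_left smult_finsum Pi_def)

lemma coefficients_munit:
  assumes "\<And>p q. f p q \<in> carrier A"
  shows "(\<Oplus>a\<in>UNIV. \<Oplus>b\<in>UNIV. munit p q $ a $ b \<odot> f a b) = f p q"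
proof -
  have "(\<Oplus>b\<in>UNIV. munit p q $ a $ b \<odot> f a b) = (if a = p then f a q else \<zero>)" for a
  proof -
    have "(\<Oplus>b\<in>UNIV. munit p q $ a $ b \<odot> f a b) =
        (\<Oplus>b\<in>UNIV. if b = q then if a = p then f a b else \<zero> else \<zero>)"
      using assms by (intro finsum_eqI) (auto simp: munit_nth)
    also have "\<dots> = (if a = p then f a q else \<zero>)"
      using assms by (intro finsum_delta) auto
    finally show ?thesis .
  qed
  then show ?thesis using assms by (simp add: finsum_delta)
qed

lemma linear_into_mult_tensor_map:
  assumes "linear_into A F" "linear_into A G"
  shows "linear_into A (mult_tensor_map A F G)"
  unfolding mult_tensor_map_def
  by (rule linear_into_coefficients) (simp add: linear_intoD[OF assms(1)] linear_intoD[OF assms(2)])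

lemma mult_tensor_map_munit:
  assumes "linear_into A F" "linear_into A G"
  shows "mult_tensor_map A F G (munit p q) =
    F (munit (fst p) (fst q)) \<otimes> G (munit (snd p) (snd q))"
  unfolding mult_tensor_map_def
  by (rule coefficients_munit) (simp add: linear_intoD[OF assms(1)] linear_intoD[OF assms(2)])

lemma mult_tensor_map_tensor:
  assumes F: "linear_into A F" and G: "linear_into A G"
  shows "mult_tensor_map A F G (tensor X Y) = F X \<otimes> G Y"
proof -
  note M = linear_into_mult_tensor_map[OF F G]
  note c = linear_intoD(1)[OF F] linear_intoD(1)[OF G]
  have 1: "mult_tensor_map A F G (tensor (munit i j) (munit k l)) = F (munit i j) \<otimes> G (munit k l)"
    for i j k l
    using mult_tensor_map_munit[OF F G, of "(i, k)" "(j, l)"] by (simp add: munit_pair)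
  have 2: "mult_tensor_map A F G (tensor (munit i j) Y) = F (munit i j) \<otimes> G Y" for i j Y
    using linear_into_eq_iff[OF linear_into_compose[OF M cmat_linear_tensor_right]
        linear_into_mult_left[OF G c(1)]] 1 by blast
  show ?thesis
    using linear_into_eq_iff[OF linear_into_compose[OF M cmat_linear_tensor_left]
        linear_into_mult_right[OF F c(2)]] 2 by blast
qed

lemma smult_eq_smult_iff:
  assumes "x \<in> carrier A" "y \<in> carrier A" "a \<noteq> 0"
  shows "a \<odot> x = a \<odot> y \<longleftrightarrow> x = y"
proof
  assume "a \<odot> x = a \<odot> y"
  then have "inverse a \<odot> (a \<odot> x) = inverse a \<odot> (a \<odot> y)" by simp
  with assms show "x = y" by simp
qed simp

lemma smult_eq_transfer:
  assumes "x \<in> carrier A" "y \<in> carrier A" "k \<noteq> 0" "k * a = a'" "k * b = b'"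
  shows "a \<odot> x = b \<odot> y \<longleftrightarrow> a' \<odot> x = b' \<odot> y"
  using smult_eq_smult_iff[of "a \<odot> x" "b \<odot> y" k] assms by auto

text \<open>
  Evaluated on matrix units the three axioms become relations between the entries \<open>e i j = S (munit i j)\<close>.
  The comultiplication contributes a factor \<open>n\<close>, the dephasing graph another one, and the axioms carry
  \<open>1 / n\<^sup>2\<close>. In \<open>t i j = r \<odot> e i j\<close> with \<open>r\<^sup>2 = n\<^sup>3\<close> all these factors cancel.
\<close>

lemma local_QCK_family_iff:
  fixes S :: "'n::finite cmat \<Rightarrow> 'u"
  assumes S: "linear_into A S"
  shows "local_QCK_family A dephasing S \<longleftrightarrow>
    local_relations A (\<lambda>i j. of_real (sqrt (real CARD('n))) \<odot> S (adapted_unit i j))"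
proof -
  define n where "n = complex_of_nat CARD('n)"
  define r where "r = complex_of_real (sqrt (real CARD('n))) * n"
  have n: "n \<noteq> 0" by (simp add: n_def)
  have nn: "inverse n * inverse n * (n * n) = 1" using n by (simp add: field_simps)
  have r0: "r \<noteq> 0" using n by (simp add: r_def)
  have "complex_of_real (sqrt (real CARD('n))) * complex_of_real (sqrt (real CARD('n))) = n"
    by (simp add: n_def flip: of_real_mult)
  then have rr: "r * r = n * n * n" by (simp add: r_def algebra_simps)
  have cr: "cnj r = r" by (simp add: r_def n_def)
  define e where "e i j = S (munit i j)" for i j
  define P where "P i j = (\<Oplus>k\<in>UNIV. e i k \<otimes> star A (e j k))" for i j
  have e [simp]: "e i j \<in> carrier A" for i j by (simp add: e_def linear_intoD[OF S])
  have P [simp]: "P i j \<in> carrier A" for i j by (simp add: P_def)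
  note S' = linear_into_star_map[OF S]
  define M where "M = mult_tensor_map A S (star_map A S)"
  have M: "linear_into A M" unfolding M_def by (rule linear_into_mult_tensor_map[OF S S'])
  have star_e: "star_map A S (munit i j) = star A (e j i)" for i j
    by (simp add: star_map_def cadj_munit e_def)
  have M_tensor: "M (tensor X Y) = S X \<otimes> star_map A S Y" for X Y
    unfolding M_def by (rule mult_tensor_map_tensor[OF S S'])
  have M_comult: "M (mat_comult (munit i j)) = n \<odot> P i j" for i j
    by (simp add: mat_comult_munit linear_intoD[OF M] linear_into_sum[OF M] n_def P_def e_def[symmetric]
        M_tensor star_e)
  have 1: "(\<forall>T. mult_tensor_map A M S (tensor_map mat_comult id T) = inverse (n^2) \<odot> S (mat_mult T))
      \<longleftrightarrow> (\<forall>i j k l. n \<odot> P i j \<otimes> e k l = inverse (n^2) \<odot> (if j = k then e i l else \<zero>))"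
  proof -
    have "(\<forall>T. mult_tensor_map A M S (tensor_map mat_comult id T) = inverse (n^2) \<odot> S (mat_mult T))
      \<longleftrightarrow> (\<forall>p q. n \<odot> P (fst p) (fst q) \<otimes> e (snd p) (snd q) =
         inverse (n^2) \<odot> (if fst q = snd p then e (fst p) (snd q) else \<zero>))"
      by (subst linear_into_eq_iff[OF
          linear_into_compose[OF linear_into_mult_tensor_map[OF M S] cmat_linear_tensor_map]
          linear_into_smult[OF linear_into_compose[OF S cmat_linear_mat_mult]]])
        (simp add: tensor_map_munit mult_tensor_map_tensor[OF M S] M_comult mat_mult_munit
          e_def if_distrib[of S] linear_into_zero[OF S])
    then show ?thesis by auto
  qed
  have 2: "(\<forall>T. mult_tensor_map A (star_map A S) S T
        = inverse (n^2) \<odot> M (mat_comult (dephasing (mat_mult T))))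
      \<longleftrightarrow> (\<forall>i j k l. star A (e j i) \<otimes> e k l = (if j = k \<and> i = l then P i i else \<zero>))"
  proof -
    have rhs: "inverse (n^2) \<odot> M (mat_comult (dephasing (mat_mult (munit p q)))) =
        (if fst q = snd p \<and> fst p = snd q then P (fst p) (fst p) else \<zero>)" for p q :: "'n \<times> 'n"
    proof -
      have "mat_comult (cscale n (munit i i)) = cscale n (mat_comult (munit i i))" for i :: 'n
        using cmat_linear_mat_comult[where ?'a = 'n] by (simp add: cmat_linear_def)
      moreover have "dephasing 0 = (0 :: 'n cmat)" "mat_comult 0 = (0 :: ('n \<times> 'n) cmat)"
        by (simp_all add: vec_eq_iff dephasing_def mat_comult_eq)
      ultimately show ?thesis
        using nn by (auto simp: mat_mult_munit dephasing_munit n_def[symmetric] linear_intoD[OF M]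
            linear_into_zero[OF M] M_comult power2_eq_square)
    qed
    have "(\<forall>T. mult_tensor_map A (star_map A S) S T
        = inverse (n^2) \<odot> M (mat_comult (dephasing (mat_mult T))))
      \<longleftrightarrow> (\<forall>p q. star A (e (fst q) (fst p)) \<otimes> e (snd p) (snd q) =
        (if fst q = snd p \<and> fst p = snd q then P (fst p) (fst p) else \<zero>))"
      by (subst linear_into_eq_iff[OF linear_into_mult_tensor_map[OF S' S]
          linear_into_smult[OF linear_into_compose[OF M cmat_linear_compose[OF cmat_linear_mat_comult
            cmat_linear_compose[OF cmat_linear_dephasing cmat_linear_mat_mult]]]]])
        (simp add: mult_tensor_map_munit[OF S' S] star_e rhs, simp add: e_def)
    then show ?thesis by auto
  qed
  have "(mat_comult (mat 1) :: ('n \<times> 'n) cmat) = (\<Sum>i\<in>UNIV. mat_comult (munit i i))"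
    by (simp add: mat_1_eq vec_eq_iff mat_comult_eq sum_distrib_left)
  then have 3: "M (mat_comult (mat 1)) = n \<odot> (\<Oplus>i\<in>UNIV. P i i)"
    by (simp add: linear_into_sum[OF M] M_comult smult_finsum)
  define t where "t i j = of_real (sqrt (real CARD('n))) \<odot> S (adapted_unit i j)" for i j
  have te: "t i j = r \<odot> e i j" for i j
    by (simp add: t_def adapted_unit_eq r_def n_def linear_intoD[OF S] e_def)
  have tt: "t i k \<otimes> star A (t j l) = (r * r) \<odot> (e i k \<otimes> star A (e j l))" for i j k l
    by (simp add: te star_smult cr smult_mult_left smult_mult_right)
  have tt': "star A (t i k) \<otimes> t j l = (r * r) \<odot> (star A (e i k) \<otimes> e j l)" for i j k l
    by (simp add: te star_smult cr smult_mult_left smult_mult_right)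
  have Pt: "(\<Oplus>k\<in>UNIV. t i k \<otimes> star A (t j k)) = (r * r) \<odot> P i j" for i j
    by (simp add: tt P_def smult_finsum)
  have "n \<odot> P i j \<otimes> e k l = inverse (n^2) \<odot> (if j = k then e i l else \<zero>) \<longleftrightarrow>
      (r * r) \<odot> P i j \<otimes> t k l = (if j = k then t i l else \<zero>)" for i j k l
  proof -
    have "n \<odot> (P i j \<otimes> e k l) = inverse (n^2) \<odot> (if j = k then e i l else \<zero>) \<longleftrightarrow>
      (r * r * r) \<odot> (P i j \<otimes> e k l) = r \<odot> (if j = k then e i l else \<zero>)"
      by (rule smult_eq_transfer[where k = "n * n * r"])
        (use n r0 in \<open>simp_all add: rr power2_eq_square field_simps\<close>)
    then show ?thesis by (auto simp: te smult_mult_left smult_mult_right mult.assoc)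
  qed
  moreover have "star A (e j i) \<otimes> e k l = (if j = k \<and> i = l then P i i else \<zero>) \<longleftrightarrow>
      star A (t j i) \<otimes> t k l = (if j = k \<and> i = l then (r * r) \<odot> P i i else \<zero>)" for i j k l
    using smult_eq_smult_iff[of "star A (e j i) \<otimes> e k l" "if j = k \<and> i = l then P i i else \<zero>" "r * r"] r0
    by (auto simp: tt')
  moreover have "n \<odot> (\<Oplus>i\<in>UNIV. P i i) = inverse (n^2) \<odot> \<one> \<longleftrightarrow>
      (\<Oplus>i\<in>UNIV. (r * r) \<odot> P i i) = \<one>"
  proof -
    have "n \<odot> (\<Oplus>i\<in>UNIV. P i i) = inverse (n^2) \<odot> \<one> \<longleftrightarrow> (r * r) \<odot> (\<Oplus>i\<in>UNIV. P i i) = 1 \<odot> \<one>"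
      by (rule smult_eq_transfer[where k = "n * n"])
        (use n nn in \<open>simp_all add: rr power2_eq_square mult.commute\<close>)
    then show ?thesis by (simp add: smult_finsum)
  qed
  moreover have "t i j \<in> carrier A" for i j by (simp add: te)
  ultimately show ?thesis
    using S 1 2 3 unfolding local_QCK_family_def local_relations_def
    by (simp add: Pt n_def[symmetric] M_def[symmetric] t_def[symmetric])
qed


lemma family_in_subalgebra_iff:
  fixes S :: "'n::finite cmat \<Rightarrow> 'u"
  assumes K: "cstar_subalgebra A K" and S: "linear_into A S" and c: "c \<noteq> 0"
  shows "range S \<subseteq> K \<longleftrightarrow> (\<forall>i j. c \<odot> S (adapted_unit i j) \<in> K)"
proof
  assume *: "\<forall>i j. c \<odot> S (adapted_unit i j) \<in> K"
  note K' = cstar_subalgebraD[OF K]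
  have "S (munit i j) \<in> K" for i j
  proof -
    have "S (munit i j) = inverse (c * of_nat CARD('n)) \<odot> (c \<odot> S (adapted_unit i j))"
    proof -
      have "inverse (c * of_nat CARD('n)) * (c * of_nat CARD('n)) = 1"
        by (rule left_inverse) (use c in simp)
      then show ?thesis
        by (simp add: adapted_unit_eq linear_intoD[OF S] del: inverse_mult_distrib)
    qed
    with * K'(5) show ?thesis by metis
  qed
  then have "S X \<in> K" for X
    by (subst linear_into_expand[OF S]) (intro cstar_subalgebra_finsum[OF K] K'(5), auto)
  then show "range S \<subseteq> K" by auto
qed (use cstar_subalgebraD(5)[OF K] in auto)

lemma local_relations_imp_family:
  fixes t :: "'n::finite \<Rightarrow> 'n \<Rightarrow> 'u"
  assumes "local_relations A t"
  obtains S where "local_QCK_family A dephasing S"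
    "\<And>i j. t i j = of_real (sqrt (real CARD('n))) \<odot> S (adapted_unit i j)"
proof -
  define n where "n = complex_of_nat CARD('n)"
  define r where "r = complex_of_real (sqrt (real CARD('n))) * n"
  have r0: "r \<noteq> 0" by (simp add: r_def n_def)
  have t: "t i j \<in> carrier A" for i j using assms by (simp add: local_relations_def)
  define S where "S X = (\<Oplus>i\<in>UNIV. \<Oplus>j\<in>UNIV. X $ i $ j \<odot> (inverse r \<odot> t i j))" for X
  have S: "linear_into A S"
    unfolding S_def by (rule linear_into_coefficients) (simp add: t)
  have "S (munit i j) = inverse r \<odot> t i j" for i j
    unfolding S_def by (rule coefficients_munit) (simp add: t)
  then have tS: "t i j = of_real (sqrt (real CARD('n))) \<odot> S (adapted_unit i j)" for i j
    using r0 by (simp add: adapted_unit_eq linear_intoD[OF S] t n_def[symmetric] mult.assoc[symmetric]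
        r_def[symmetric])
  show ?thesis
  proof (rule that[OF _ tS])
    show "local_QCK_family A dephasing S"
      using assms unfolding local_QCK_family_iff[OF S] by (simp flip: tS)
  qed
qed

end

section \<open>The isomorphism\<close>

text \<open>
  The fixed points form a closed set because homomorphisms are contractive. This is how two homomorphisms
  that agree on generators are seen to be equal.
\<close>

lemma fixed_points_subalgebra:
  assumes A: "cstar_algebra A" and hom: "star_hom A A \<alpha>"
  shows "cstar_subalgebra A {x \<in> carrier A. \<alpha> x = x}"
proof -
  interpret cstar_algebra A by fact
  note hom' = star_homD[OF hom]
  have limit: "\<alpha> l = l" if \<sigma>: "range \<sigma> \<subseteq> {x \<in> carrier A. \<alpha> x = x}" and l: "tends \<sigma> l" for \<sigma> l
  proof -
    have fix_\<sigma>: "\<sigma> n \<in> carrier A" "\<alpha> (\<sigma> n) = \<sigma> n" for n using \<sigma> by auto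
    have lc: "l \<in> carrier A" using l by (simp add: tends_def)
    have "tends (\<lambda>n. \<alpha> (\<sigma> n)) (\<alpha> l)"
    proof (rule tends_lipschitz[OF l, where K = 1])
      have "\<alpha> (\<sigma> n) \<ominus>\<^bsub>A\<^esub> \<alpha> l = \<alpha> (\<sigma> n \<ominus>\<^bsub>A\<^esub> l)" for n
        using fix_\<sigma>(1) lc by (simp add: minus_eq_smult hom')
      then show "cnorm A (\<alpha> (\<sigma> n) \<ominus>\<^bsub>A\<^esub> \<alpha> l) \<le> 1 * cnorm A (\<sigma> n \<ominus>\<^bsub>A\<^esub> l)" for n
        using star_hom_contractive[OF A pre_cstar_algebra_axioms hom] fix_\<sigma>(1) lc by simp
    qed (use fix_\<sigma>(1) lc in \<open>auto simp: hom'(1)\<close>)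
    then show ?thesis using l tends_unique by (simp add: fix_\<sigma>(2))
  qed
  have "\<alpha> \<zero>\<^bsub>A\<^esub> = \<zero>\<^bsub>A\<^esub>"
    by (rule star_hom_zero[OF pre_cstar_algebra_axioms pre_cstar_algebra_axioms hom])
  then show ?thesis
    unfolding cstar_subalgebra_iff
  proof (intro conjI allI impI)
    fix \<sigma> l assume *: "range \<sigma> \<subseteq> {x \<in> carrier A. \<alpha> x = x} \<and> tends \<sigma> l"
    then have "l \<in> carrier A" by (simp add: tends_def)
    with * show "l \<in> {x \<in> carrier A. \<alpha> x = x}"
      using limit[of \<sigma> l] by blast
  qed (auto simp: hom')
qed

theorem corollary4p4:
  fixes C :: "'u cstar" and s :: "complex^'n^'n \<Rightarrow> 'u"
    and t :: "'n::finite \<Rightarrow> 'n \<Rightarrow> 'u" and V :: "'n \<Rightarrow> 'u"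
  defines "LO \<equiv> cstar_generated C (range s)"
  assumes universal: "universal_local_QCK_family C dephasing s"
    and t: "\<And>i j. t i j = of_real (sqrt (real CARD('n))) \<odot>\<^bsub>C\<^esub> s (adapted_unit i j)"
    and V: "\<And>i. V i = (\<Oplus>\<^bsub>C\<^esub>j\<in>UNIV. t i j)"
  shows "cuntz_isometries LO V \<and>
    carrier (cstar_generated LO (range V)) = carrier LO \<and>
    (\<forall>(Q :: 'u cstar) (v :: 'n \<Rightarrow> 'u). is_cuntz_algebra Q v \<longrightarrow> cstar_isomorphic LO Q)"
proof -
  let ?c = "complex_of_real (sqrt (real CARD('n)))"
  have C: "cstar_algebra C" and fam: "local_QCK_family C dephasing s"
    using universal by (auto simp: universal_local_QCK_family_def)
  interpret C: cstar_algebra C by (rule C)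
  have lin: "linear_into C s" using fam by (simp add: local_QCK_family_def)
  have s [simp]: "s X \<in> carrier C" for X by (rule C.linear_intoD[OF lin])
  have rel: "local_relations C t"
    using fam unfolding C.local_QCK_family_iff[OF lin] by (simp flip: t)
  have V_eq: "V = (\<lambda>i. \<Oplus>\<^bsub>C\<^esub>j\<in>UNIV. t i j)" by (simp add: fun_eq_iff V)
  have cuntz_V: "cuntz_isometries C V"
    and t_V: "t i j = V i \<otimes>\<^bsub>C\<^esub> (V j \<otimes>\<^bsub>C\<^esub> star C (V j))" for i j
    unfolding V_eq by (rule C.local_relations_imp_cuntz[OF rel])+
  \<comment> \<open>The closed subalgebra generated by \<open>V\<close> contains each \<open>t i j\<close>, and these span the range of \<open>s\<close>.\<close>
  have generates: "range s \<subseteq> K" if K: "cstar_subalgebra C K" "range V \<subseteq> K" for K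
  proof -
    have "t i j \<in> K" for i j
      unfolding t_V using K(2) by (intro C.cstar_subalgebraD(6,7)[OF K(1)]) auto
    then show ?thesis using C.family_in_subalgebra_iff[OF K(1) lin, of ?c] by (simp add: t)
  qed
  define H where "H = cstar_subalgebra C hull range s"
  have LO: "LO = C\<lparr>carrier := H\<rparr>" by (simp add: LO_def cstar_generated_def H_def)
  have H: "cstar_subalgebra C H" "H \<subseteq> carrier C"
    unfolding H_def using C.cstar_subalgebra_hull[of "range s"] s by blast+
  have "range s \<subseteq> H" unfolding H_def by (rule hull_subset)
  then have tH: "t i j \<in> H" for i j
    using C.family_in_subalgebra_iff[OF H(1) lin, of ?c] by (simp add: t)
  have VH: "V i \<in> H" for i
    unfolding V by (intro C.cstar_subalgebra_finsum[OF H(1)] tH) simp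
  have VVH: "V i \<otimes>\<^bsub>C\<^esub> star C (V i) \<in> H" for i
    by (intro C.cstar_subalgebraD(6,7)[OF H(1)] VH)
  \<comment> \<open>The unit lies in the generated algebra because it is the sum of the range projections.\<close>
  have "(\<Oplus>\<^bsub>C\<^esub>i\<in>UNIV. V i \<otimes>\<^bsub>C\<^esub> star C (V i)) \<in> H"
    by (intro C.cstar_subalgebra_finsum[OF H(1)] VVH) simp
  then have one: "\<one>\<^bsub>C\<^esub> \<in> H" using cuntz_V by (simp add: cuntz_isometries_def)
  note sub = C H(1) one
  have LO_cstar: "cstar_algebra LO"
    unfolding LO by (rule subalgebra_cstar_algebra[OF sub])
  interpret LO: cstar_algebra LO by (rule LO_cstar)
  have cuntz_LO: "cuntz_isometries LO V"
    using cuntz_V finsum_subalgebra[OF sub, of UNIV "\<lambda>i. V i \<otimes>\<^bsub>C\<^esub> star C (V i)"]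
    by (simp add: cuntz_isometries_def LO VH VVH)
  have whole: "K = H" if "cstar_subalgebra LO K" "range V \<subseteq> K" for K
  proof
    have K: "cstar_subalgebra C K" "K \<subseteq> H"
      using that(1) unfolding LO cstar_subalgebra_trans[OF sub] by auto
    show "K \<subseteq> H" by (rule K(2))
    show "H \<subseteq> K"
      unfolding H_def using generates[OF K(1) that(2)] K(1) by (rule hull_minimal)
  qed
  have "cstar_subalgebra LO hull range V = H"
    by (rule whole[OF LO.cstar_subalgebra_hull(1) hull_subset]) (use VH in \<open>auto simp: LO\<close>)
  then have gen: "carrier (cstar_generated LO (range V)) = carrier LO"
    by (simp add: cstar_generated_def LO)
  have "cstar_isomorphic LO Q" if Q: "is_cuntz_algebra Q v" for Q :: "'u cstar" and v :: "'n \<Rightarrow> 'u"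
  proof -
    have Qc: "cstar_algebra Q" and v: "cuntz_isometries Q v"
      and gen_v: "cstar_subalgebra Q hull range v = carrier Q"
      using Q by (auto simp: is_cuntz_algebra_def cstar_generated_def)
    interpret Q: cstar_algebra Q by (rule Qc)
    obtain \<phi> where \<phi>: "star_hom Q LO \<phi>" "\<And>i. \<phi> (v i) = V i"
      using Q LO_cstar cuntz_LO unfolding is_cuntz_algebra_def by blast
    \<comment> \<open>The Cuntz isometries give a family in \<open>Q\<close>, so universality of \<open>s\<close> applies to it.\<close>
    define \<tau> where "\<tau> i j = v i \<otimes>\<^bsub>Q\<^esub> (v j \<otimes>\<^bsub>Q\<^esub> star Q (v j))" for i j
    have \<tau>: "local_relations Q \<tau>" and v_\<tau>: "v i = (\<Oplus>\<^bsub>Q\<^esub>j\<in>UNIV. \<tau> i j)" for i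
      unfolding \<tau>_def using Q.cuntz_imp_local_relations[OF v] by auto
    obtain S where S: "local_QCK_family Q dephasing S"
      and \<tau>_S: "\<And>i j. \<tau> i j = ?c \<odot>\<^bsub>Q\<^esub> S (adapted_unit i j)"
      using Q.local_relations_imp_family[OF \<tau>] by blast
    have linS: "linear_into Q S" using S by (simp add: local_QCK_family_def)
    have SQ: "range S \<subseteq> carrier Q" using Q.linear_intoD[OF linS] by auto
    have "cstar_generated Q (range S) = Q"
    proof -
      let ?K = "cstar_subalgebra Q hull range S"
      note K = Q.cstar_subalgebra_hull[OF SQ]
      have "\<tau> i j \<in> ?K" for i j
        using Q.family_in_subalgebra_iff[OF K(1) linS, of ?c] hull_subset[of "range S"]
        by (simp add: \<tau>_S)
      then have "v i \<in> ?K" for i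
        unfolding v_\<tau> by (intro Q.cstar_subalgebra_finsum[OF K(1)]) auto
      then have "carrier Q \<subseteq> ?K"
        using hull_minimal[of "range v" ?K "cstar_subalgebra Q"] K(1) gen_v by auto
      with K(2) have "?K = carrier Q" by simp
      then show ?thesis by (simp add: cstar_generated_def)
    qed
    then obtain \<rho> where \<rho>: "star_hom LO Q \<rho>" "\<rho> ` carrier LO = carrier Q" "\<rho> \<circ> s = S"
      using universal Qc S unfolding universal_local_QCK_family_def LO_def by metis
    have "\<rho> (V i) = v i" for i
    proof -
      have \<rho>_t: "\<rho> (t i j) = \<tau> i j" for j
      proof -
        have "\<rho> (t i j) = \<rho> (?c \<odot>\<^bsub>LO\<^esub> s (adapted_unit i j))" by (simp add: t LO)
        also have "\<dots> = ?c \<odot>\<^bsub>Q\<^esub> \<rho> (s (adapted_unit i j))"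
          using \<open>range s \<subseteq> H\<close> by (intro star_homD[OF \<rho>(1)]) (auto simp: LO)
        finally show ?thesis using \<rho>(3) by (auto simp: \<tau>_S)
      qed
      have "\<rho> (V i) = \<rho> (\<Oplus>\<^bsub>LO\<^esub>j\<in>UNIV. t i j)"
        using finsum_subalgebra[OF sub, of UNIV "t i"] by (simp add: V LO tH)
      also have "\<dots> = (\<Oplus>\<^bsub>Q\<^esub>j\<in>UNIV. \<rho> (t i j))"
        by (rule star_hom_finsum[OF LO.pre_cstar_algebra_axioms Q.pre_cstar_algebra_axioms \<rho>(1)])
          (simp_all add: LO tH)
      finally show ?thesis by (simp add: \<rho>_t v_\<tau>)
    qed
    \<comment> \<open>Hence \<open>\<phi> \<circ> \<rho>\<close> fixes the generators \<open>V\<close>, and therefore all of \<open>LO\<close>.\<close>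
    then have "range V \<subseteq> {x \<in> carrier LO. (\<phi> \<circ> \<rho>) x = x}"
      using VH \<phi>(2) by (auto simp: LO)
    then have "{x \<in> carrier LO. (\<phi> \<circ> \<rho>) x = x} = H"
      by (intro whole fixed_points_subalgebra LO_cstar star_hom_compose[OF \<rho>(1) \<phi>(1)])
    then have "inj_on \<rho> (carrier LO)"
      by (intro inj_on_inverseI[of _ \<phi>]) (auto simp: LO)
    with \<rho> show ?thesis by (auto simp: cstar_isomorphic_def bij_betw_def)
  qed
  with cuntz_LO gen show ?thesis by blast
qed

end
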